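(* Consider the advanced model (without $\mathbf{RandEdge}$ queries), where $n$ is unknown to the algorithm, and let $\varepsilon\in(0,1)$. (a) There is a randomized algorithm that outputs a $(1+\varepsilon)$-approximation to $d$ using $\widetilde{O}\left(\varepsilon^{-2}\sqrt{n/d}\right)$ queries. (b) Any algorithm that outputs a constant factor approximation to $d$ in this setting requires $\Omega(\sqrt{n/d})$ samples. This holds even in the stronger full adjacency model.
   Context: $G=(V,E)$ is an unknown simple undirected graph with $n=|V|$ vertices and $m=|E|$ edges, no isolated vertices, and average degree $d=2m/n$. Access to $G$ is only through oracles: - $\mathbf{RandVert}()$ returns a uniformly random vertex. - $\mathbf{RandNbr}(x)$ returns a uniformly random neighbor of $x$. - $\mathbf{Degree}(x)$ returns $\deg(x)$. - $\mathbf{Additive}(S)$, for $S\subseteq V$, returns the number of edges with both endpoints in $S$ and costs $|S|$. - $\mathbf{FullNbrHood}(x)$ returns the full adjacency list of $x$. All queries other than $\mathbf{Additive}$ cost $1$. The advanced model gives $\mathbf{RandVert}$, $\mathbf{RandNbr}$, $\mathbf{Degree}$ and $\mathbf{Additive}$. The full adjacency model gives $\mathbf{RandVert}$, $\mathbf{RandNbr}$, $\mathbf{Degree}$ and $\mathbf{FullNbrHood}$. "$n$ unknown" means the algorithm is not given $n$; vertex identifiers reveal no information about $n$. A $(1+\varepsilon)$-approximation to $d$ is a value in $[(1-\varepsilon)d,(1+\varepsilon)d]$. A constant factor approximation is a value in $[d/c,cd]$ for a constant $c$. Randomized guarantees hold with probability at least $0.99$. $\widetilde{O}$ hides factors polylogarithmic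 in $n$. *)

theory Defs
  imports "HOL-Probability.SPMF"
begin

section \<open>Graphs\<close>

text \<open>
  A graph is a pair of a vertex set and a set of two-element edges.  Vertices are named by
  natural numbers, but the vertex set may be \<^emph>\<open>any\<close> finite nonempty set of them, and all guarantees
  range over every such choice: this is how identifiers carry no information about the
  number of vertices.
\<close>

type_synonym graph = "nat set \<times> nat set set"

abbreviation verts :: "graph \<Rightarrow> nat set" where "verts G \<equiv> fst G"
abbreviation edges :: "graph \<Rightarrow> nat set set" where "edges G \<equiv> snd G"

definition nbrs :: "graph \<Rightarrow> nat \<Rightarrow> nat set" where
  "nbrs G x = {y. {x, y} \<in> edges G}"

definition simple_graph :: "graph \<Rightarrow> bool" where
  "simple_graph G \<longleftrightarrow> finite (verts G) \<and> verts G \<noteq> {} \<and> (\<forall>e\<in>edges G. e \<subseteq> verts G \<and> card e = 2)"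

definition no_isolated :: "graph \<Rightarrow> bool" where
  "no_isolated G \<longleftrightarrow> (\<forall>x\<in>verts G. nbrs G x \<noteq> {})"

definition input_graph :: "graph \<Rightarrow> bool" where
  "input_graph G \<longleftrightarrow> simple_graph G \<and> no_isolated G"

definition avg_degree :: "graph \<Rightarrow> real" where
  "avg_degree G = 2 * real (card (edges G)) / real (card (verts G))"


section \<open>Oracles\<close>

datatype query =
    RandVert
  | RandNbr nat
  | Degree nat
  | Additive "nat set"
  | FullNbrHood nat

text \<open>Adjacency lists are returned as sets, so that their order carries no information.\<close>

datatype answer = Vertex nat | Number nat | NbrSet "nat set" | Refused

datatype model = Advanced | FullAdjacency

fun offers :: "model \<Rightarrow> query \<Rightarrow> bool" where
  "offers M (Additive S) \<longleftrightarrow> M = Advanced"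
| "offers M (FullNbrHood x) \<longleftrightarrow> M = FullAdjacency"
| "offers M _ \<longleftrightarrow> True"

fun query_cost :: "query \<Rightarrow> nat" where
  "query_cost (Additive S) = card S"
| "query_cost _ = 1"

fun mentioned :: "query \<Rightarrow> nat set" where
  "mentioned RandVert = {}"
| "mentioned (RandNbr x) = {x}"
| "mentioned (Degree x) = {x}"
| "mentioned (Additive S) = S"
| "mentioned (FullNbrHood x) = {x}"

fun revealed :: "answer \<Rightarrow> nat set" where
  "revealed (Vertex x) = {x}"
| "revealed (NbrSet X) = X"
| "revealed _ = {}"

fun true_answer :: "graph \<Rightarrow> query \<Rightarrow> answer pmf" where
  "true_answer G RandVert = map_pmf Vertex (pmf_of_set (verts G))"
| "true_answer G (RandNbr x) = map_pmf Vertex (pmf_of_set (nbrs G x))"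
| "true_answer G (Degree x) = return_pmf (Number (card (nbrs G x)))"
| "true_answer G (Additive S) = return_pmf (Number (card {e \<in> edges G. e \<subseteq> S}))"
| "true_answer G (FullNbrHood x) = return_pmf (NbrSet (nbrs G x))"

text \<open>
  The set \<open>K\<close> holds the identifiers revealed so far.  A query that mentions any other identifier is
  refused; otherwise guessing identifiers would act as a membership test for the vertex set,
  which is not among the oracles.
\<close>

definition respond :: "model \<Rightarrow> graph \<Rightarrow> nat set \<Rightarrow> query \<Rightarrow> answer pmf" where
  "respond M G K q =
     (if offers M q \<and> mentioned q \<subseteq> K then true_answer G q else return_pmf Refused)"


section \<open>Randomized query algorithms\<close>

text \<open>
  A program is a possibly infinite interaction tree, which can stop with a result, make a
  query and continue depending on the answer, or use internal randomness.  It refers to no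
  graph, so in particular it does not know the number of vertices.
\<close>

codatatype 'a program =
    Output 'a
  | Query query "answer \<Rightarrow> 'a program"
  | Choose "'a program pmf"

text \<open>
  \<open>run M G K p\<close> is the joint distribution of the result of \<open>p\<close> and the total cost of its
  queries; it is a subprobability distribution, whose missing mass is the probability that \<open>p\<close>
  does not stop.
\<close>

partial_function (spmf) run ::
  "model \<Rightarrow> graph \<Rightarrow> nat set \<Rightarrow> 'a program \<Rightarrow> ('a \<times> nat) spmf" where
  "run M G K p =
     (case p of
        Output r \<Rightarrow> return_spmf (r, 0)
      | Query q f \<Rightarrow>
          bind_spmf (spmf_of_pmf (respond M G K q))
            (\<lambda>a. map_spmf (\<lambda>(r, t). (r, query_cost q + t)) (run M G (K \<union> revealed a) (f a)))
      | Choose D \<Rightarrow> bind_spmf (spmf_of_pmf D) (\<lambda>p'. run M G K p'))"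

text \<open>The probability that \<open>p\<close> stops with a result and a total cost satisfying \<open>P\<close>.\<close>

definition run_prob :: "model \<Rightarrow> graph \<Rightarrow> 'a program \<Rightarrow> ('a \<Rightarrow> nat \<Rightarrow> bool) \<Rightarrow> real" where
  "run_prob M G p P = measure (measure_spmf (run M G {} p)) {(r, t). P r t}"

definition eps_approx :: "real \<Rightarrow> graph \<Rightarrow> real \<Rightarrow> bool" where
  "eps_approx \<epsilon> G r \<longleftrightarrow> (1 - \<epsilon>) * avg_degree G \<le> r \<and> r \<le> (1 + \<epsilon>) * avg_degree G"

definition factor_approx :: "real \<Rightarrow> graph \<Rightarrow> real \<Rightarrow> bool" where
  "factor_approx c G r \<longleftrightarrow> avg_degree G / c \<le> r \<and> r \<le> c * avg_degree G"

end

theory Submission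
  imports Defs
begin

text \<open>
  \<^bold>\<open>Upper bound.\<close>  Order the vertices by degree.  For a uniformly random vertex \<open>v\<close> and a uniformly
  random neighbor \<open>u\<close> of \<open>v\<close>, the variable that is \<open>deg v\<close> if \<open>u\<close> is above \<open>v\<close> and \<open>0\<close> otherwise has
  mean \<open>d/2\<close> and second moment at most \<open>d \<cdot> sqrt (n d)\<close>, because a vertex has at most \<open>sqrt (n d)\<close>
  neighbors above it; so the average of \<open>O(\<epsilon>\<^sup>-\<^sup>2 sqrt (n/d))\<close> samples suffices.  What is missing is the
  sample size.  It is found by doubling \<open>q\<close> until one of two statistics is at least \<open>1\<close>, both of mean
  \<open>O(q\<^sup>2 d/n)\<close>, so that by Markov's inequality stopping before \<open>q = sqrt (n/d)\<close> is unlikely.  The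
  first is the number of edges within \<open>2q\<close> random vertices.  For the second, let \<open>Z\<close> be the sum of
  \<open>q\<close> of the above variables and \<open>u\<close> the sampled neighbor of maximal degree: it is \<open>Z / deg u\<close> times
  the number of \<open>q\<close> independent random vertices that are adjacent to \<open>u\<close>.  When \<open>q\<close> is a large multiple
  of \<open>sqrt (n/d)\<close>, one of them is at least \<open>1\<close> with high probability by Chebyshev's inequality: the first if
  at least half of the edges have both ends of degree \<open>O(n/q)\<close>, the second otherwise.

  \<^bold>\<open>Lower bound.\<close>  Adding a disjoint clique on \<open>\<Theta>(sqrt (n d))\<close> vertices increases the average
  degree by a large constant factor, but an algorithm notices it only once \<open>RandVert\<close> hits the clique, which
  takes \<open>\<Omega>(sqrt (n/d))\<close> queries.  Any single execution of cost \<open>t\<close> has almost the same probability,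
  up to a factor \<open>(n/(n+k))\<^sup>t\<close>, on both graphs.
\<close>

section \<open>Finitely supported distributions\<close>

lemma pmf_expectation_bind_finite:
  fixes h :: "'b \<Rightarrow> real"
  assumes "finite (set_pmf p)" "\<And>x. x \<in> set_pmf p \<Longrightarrow> finite (set_pmf (f x))"
  shows "measure_pmf.expectation (bind_pmf p f) h
    = measure_pmf.expectation p (\<lambda>x. measure_pmf.expectation (f x) h)"
proof -
  have "measure_pmf.expectation (bind_pmf p f) h
      = (\<Sum>x\<in>set_pmf p. pmf p x *\<^sub>R measure_pmf.expectation (f x) h)"
    using assms by (intro pmf_expectation_bind) auto
  also have "\<dots> = measure_pmf.expectation p (\<lambda>x. measure_pmf.expectation (f x) h)"
    using assms(1) by (subst integral_measure_pmf[of "set_pmf p"]) auto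
  finally show ?thesis .
qed

lemma pmf_expectation_mono_finite:
  fixes f g :: "'a \<Rightarrow> real"
  assumes "finite (set_pmf p)" "\<And>x. x \<in> set_pmf p \<Longrightarrow> f x \<le> g x"
  shows "measure_pmf.expectation p f \<le> measure_pmf.expectation p g"
  using assms by (intro integral_mono_AE integrable_measure_pmf_finite AE_pmfI) auto

lemma pmf_expectation_cong:
  fixes f g :: "'a \<Rightarrow> real"
  assumes "\<And>x. x \<in> set_pmf p \<Longrightarrow> f x = g x"
  shows "measure_pmf.expectation p f = measure_pmf.expectation p g"
  using assms by (intro integral_cong_AE AE_pmfI) auto

lemma pmf_expectation_swap:
  fixes h :: "'a \<Rightarrow> 'b \<Rightarrow> real"
  assumes "finite (set_pmf p)" "finite (set_pmf q)"
  shows "measure_pmf.expectation p (\<lambda>x. measure_pmf.expectation q (h x))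
    = measure_pmf.expectation q (\<lambda>y. measure_pmf.expectation p (\<lambda>x. h x y))"
proof -
  have "measure_pmf.expectation p (\<lambda>x. measure_pmf.expectation q (h x))
     = (\<Sum>x\<in>set_pmf p. pmf p x * (\<Sum>y\<in>set_pmf q. pmf q y * h x y))"
    using assms by (subst integral_measure_pmf[of "set_pmf p"], simp, simp)
      (simp add: integral_measure_pmf[of "set_pmf q"])
  also have "\<dots> = (\<Sum>x\<in>set_pmf p. \<Sum>y\<in>set_pmf q. pmf q y * (pmf p x * h x y))"
    by (simp add: sum_distrib_left mult_ac)
  also have "\<dots> = (\<Sum>y\<in>set_pmf q. \<Sum>x\<in>set_pmf p. pmf q y * (pmf p x * h x y))"
    by (rule sum.swap)
  also have "\<dots> = (\<Sum>y\<in>set_pmf q. pmf q y * (\<Sum>x\<in>set_pmf p. pmf p x * h x y))"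
    by (simp add: sum_distrib_left)
  also have "\<dots> = measure_pmf.expectation q (\<lambda>y. measure_pmf.expectation p (\<lambda>x. h x y))"
    using assms by (subst integral_measure_pmf[of "set_pmf q"], simp, simp)
      (simp add: integral_measure_pmf[of "set_pmf p"])
  finally show ?thesis .
qed

section \<open>Markov and Chebyshev inequalities\<close>

lemma pmf_prob_le_expectation:
  fixes f :: "'a \<Rightarrow> real"
  assumes "finite (set_pmf p)" "\<And>x. x \<in> set_pmf p \<Longrightarrow> 0 \<le> f x"
    and "\<And>x. x \<in> set_pmf p \<Longrightarrow> x \<in> A \<Longrightarrow> 1 \<le> f x"
  shows "measure_pmf.prob p A \<le> measure_pmf.expectation p f"
proof -
  have "measure_pmf.prob p A = measure_pmf.expectation p (indicat_real A)" by simp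
  also have "\<dots> \<le> measure_pmf.expectation p f"
    using assms by (intro pmf_expectation_mono_finite) (auto simp: indicator_def)
  finally show ?thesis .
qed

text \<open>Markov's inequality for (f - mean)^2 / a^2, which is at least 1 on \<open>A\<close>. The
  variance is written in raw moments, so that the moment formulas for sums rewrite it
  directly.\<close>

lemma pmf_Chebyshev:
  fixes f :: "'a \<Rightarrow> real"
  assumes fin: "finite (set_pmf p)" and a: "a > 0"
    and A: "\<And>x. x \<in> set_pmf p \<Longrightarrow> x \<in> A \<Longrightarrow> a \<le> \<bar>f x - measure_pmf.expectation p f\<bar>"
  shows "measure_pmf.prob p A
    \<le> (measure_pmf.expectation p (\<lambda>x. (f x)\<^sup>2) - (measure_pmf.expectation p f)\<^sup>2) / a\<^sup>2"
proof -
  let ?m = "measure_pmf.expectation p f"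
  note int = integrable_measure_pmf_finite[OF fin]
  have "measure_pmf.prob p A \<le> measure_pmf.expectation p (\<lambda>x. (f x - ?m)\<^sup>2 / a\<^sup>2)"
  proof (rule pmf_prob_le_expectation[OF fin])
    fix x assume "x \<in> set_pmf p" "x \<in> A"
    then have "a\<^sup>2 \<le> \<bar>f x - ?m\<bar>\<^sup>2" using A a by (intro power_mono) auto
    then show "1 \<le> (f x - ?m)\<^sup>2 / a\<^sup>2" using a by simp
  qed simp
  also have "\<dots> = measure_pmf.expectation p (\<lambda>x. (f x)\<^sup>2 - 2 * ?m * f x + ?m\<^sup>2) / a\<^sup>2"
    by (simp add: power2_eq_square algebra_simps)
  also have "measure_pmf.expectation p (\<lambda>x. (f x)\<^sup>2 - 2 * ?m * f x + ?m\<^sup>2)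
      = measure_pmf.expectation p (\<lambda>x. (f x)\<^sup>2) - 2 * ?m * ?m + ?m\<^sup>2"
    by (simp add: Bochner_Integration.integral_add Bochner_Integration.integral_diff int)
  finally show ?thesis by (simp add: power2_eq_square)
qed

lemma pmf_expectation_add:
  fixes f g :: "'a \<Rightarrow> real"
  assumes "finite (set_pmf p)"
  shows "measure_pmf.expectation p (\<lambda>x. f x + g x) = measure_pmf.expectation p f + measure_pmf.expectation p g"
  using assms by (intro Bochner_Integration.integral_add integrable_measure_pmf_finite)

section \<open>Moments and tails of sums of independent samples\<close>

lemma finite_set_replicate_pmf: "finite (set_pmf p) \<Longrightarrow> finite (set_pmf (replicate_pmf N p))"
  by (induction N) auto

lemma expectation_replicate_pmf_Suc:
  fixes h :: "'a list \<Rightarrow> real"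
  assumes "finite (set_pmf p)"
  shows "measure_pmf.expectation (replicate_pmf (Suc N) p) h
    = measure_pmf.expectation p (\<lambda>x. measure_pmf.expectation (replicate_pmf N p) (\<lambda>xs. h (x # xs)))"
  using assms finite_set_replicate_pmf[OF assms, of N]
  by (simp add: pmf_expectation_bind_finite)

lemma expectation_replicate_sum_list:
  fixes f :: "'a \<Rightarrow> real"
  assumes fin: "finite (set_pmf p)"
  shows "measure_pmf.expectation (replicate_pmf N p) (\<lambda>xs. \<Sum>x\<leftarrow>xs. f x)
    = real N * measure_pmf.expectation p f"
proof (induction N)
  case (Suc N)
  then show ?case
    by (simp add: expectation_replicate_pmf_Suc[OF fin] pmf_expectation_add fin finite_set_replicate_pmf
      algebra_simps del: replicate_pmf.simps)
qed simp

text \<open>Expanding the square gives N diagonal terms and N (N - 1) ordered pairs of independent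
  factors; the induction splits off one sample and its cross term.\<close>

lemma expectation_replicate_sum_list_square:
  fixes f :: "'a \<Rightarrow> real"
  assumes fin: "finite (set_pmf p)"
  shows "measure_pmf.expectation (replicate_pmf N p) (\<lambda>xs. (\<Sum>x\<leftarrow>xs. f x)\<^sup>2)
    = real N * measure_pmf.expectation p (\<lambda>x. (f x)\<^sup>2)
      + real N * (real N - 1) * (measure_pmf.expectation p f)\<^sup>2"
proof (induction N)
  case (Suc N)
  let ?m = "measure_pmf.expectation p f"
  let ?S = "\<lambda>xs. \<Sum>x\<leftarrow>xs. f x"
  have "measure_pmf.expectation (replicate_pmf N p) (\<lambda>xs. (?S (x # xs))\<^sup>2)
      = (f x)\<^sup>2 + 2 * f x * (real N * ?m) + measure_pmf.expectation (replicate_pmf N p) (\<lambda>xs. (?S xs)\<^sup>2)" for x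
  proof -
    have "(?S (x # xs))\<^sup>2 = (f x)\<^sup>2 + 2 * f x * ?S xs + (?S xs)\<^sup>2" for xs
      by (simp add: power2_eq_square algebra_simps)
    then show ?thesis by (simp add: expectation_replicate_sum_list[OF fin]
      pmf_expectation_add fin finite_set_replicate_pmf)
  qed
  then show ?case
    using Suc
    by (simp add: expectation_replicate_pmf_Suc[OF fin] pmf_expectation_add fin algebra_simps power2_eq_square del: replicate_pmf.simps)
qed simp

text \<open>The variance of the sum is N times the variance of \<open>f\<close>, which is at most
  the second moment of \<open>f\<close>.\<close>

lemma replicate_pmf_Chebyshev:
  fixes f :: "'a \<Rightarrow> real"
  assumes fin: "finite (set_pmf p)" and a: "a > 0"
    and A: "\<And>xs. xs \<in> A \<Longrightarrow> a \<le> \<bar>(\<Sum>x\<leftarrow>xs. f x) - real N * measure_pmf.expectation p f\<bar>"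
  shows "measure_pmf.prob (replicate_pmf N p) A
    \<le> real N * measure_pmf.expectation p (\<lambda>x. (f x)\<^sup>2) / a\<^sup>2"
proof -
  let ?m = "measure_pmf.expectation p f"
  have "measure_pmf.prob (replicate_pmf N p) A
      \<le> (real N * measure_pmf.expectation p (\<lambda>x. (f x)\<^sup>2) + real N * (real N - 1) * ?m\<^sup>2 - (real N * ?m)\<^sup>2) / a\<^sup>2"
    using pmf_Chebyshev[OF finite_set_replicate_pmf[OF fin] a, where A = A and f = "\<lambda>xs. \<Sum>x\<leftarrow>xs. f x"] A
    by (simp only: expectation_replicate_sum_list[OF fin] expectation_replicate_sum_list_square[OF fin])
  also have "\<dots> \<le> real N * measure_pmf.expectation p (\<lambda>x. (f x)\<^sup>2) / a\<^sup>2"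
    by (intro divide_right_mono) (simp_all add: algebra_simps power2_eq_square)
  finally show ?thesis .
qed

lemma replicate_pmf_lower_tail:
  fixes f :: "'a \<Rightarrow> real"
  assumes fin: "finite (set_pmf p)" and pos: "measure_pmf.expectation p f > 0" "N > 0"
  shows "measure_pmf.prob (replicate_pmf N p) {xs. (\<Sum>x\<leftarrow>xs. f x) < real N * measure_pmf.expectation p f / 2}
    \<le> 4 * measure_pmf.expectation p (\<lambda>x. (f x)\<^sup>2) / (real N * (measure_pmf.expectation p f)\<^sup>2)"
proof -
  let ?m = "measure_pmf.expectation p f"
  have "measure_pmf.prob (replicate_pmf N p) {xs. (\<Sum>x\<leftarrow>xs. f x) < real N * ?m / 2}
     \<le> real N * measure_pmf.expectation p (\<lambda>x. (f x)\<^sup>2) / (real N * ?m / 2)\<^sup>2"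
  proof (rule replicate_pmf_Chebyshev[OF fin])
    show 0: "0 < real N * ?m / 2" using pos by simp
    show "real N * ?m / 2 \<le> \<bar>(\<Sum>x\<leftarrow>xs. f x) - real N * ?m\<bar>"
      if "xs \<in> {xs. (\<Sum>x\<leftarrow>xs. f x) < real N * ?m / 2}" for xs
      using that 0 by simp
  qed
  also have "\<dots> = 4 * measure_pmf.expectation p (\<lambda>x. (f x)\<^sup>2) / (real N * ?m\<^sup>2)"
    using pos by (simp add: power2_eq_square mult_ac)
  finally show ?thesis .
qed

text \<open>
  Second moment method.  The bound \<open>b\<close> on the fraction of elements related to a fixed one controls
  the covariance of the pairs that share an element.
\<close>

lemma no_related_pair_prob_le:
  fixes p :: "'a pmf" and h :: "'a \<Rightarrow> 'a \<Rightarrow> real"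
  assumes fin: "finite (set_pmf p)" and N: "N > 0"
    and h: "\<And>x y. h x y = 0 \<or> h x y = 1"
    and left: "\<And>x. measure_pmf.expectation p (h x) \<le> b"
    and right: "\<And>y. measure_pmf.expectation p (\<lambda>x. h x y) \<le> b"
    and e: "e = measure_pmf.expectation p (\<lambda>x. measure_pmf.expectation p (h x))" "e > 0"
  shows "measure_pmf.expectation (replicate_pmf N p) (\<lambda>xs.
       measure_pmf.prob (replicate_pmf N p) {ys. \<forall>x\<in>set xs. \<forall>y\<in>set ys. h x y = 0})
    \<le> (1 + 2 * real N * b) / ((real N)\<^sup>2 * e)"
proof -
  let ?E = "measure_pmf.expectation p" and ?R = "replicate_pmf N p"
  let ?ER = "measure_pmf.expectation ?R"
  note finR = finite_set_replicate_pmf[OF fin, of N]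
  note add = pmf_expectation_add[OF fin] pmf_expectation_add[OF finR]
  define F where "F x ys = (\<Sum>y\<leftarrow>ys. h x y)" for x ys
  \<comment> \<open>\<open>W\<close> counts related pairs, one element from each list, with
    multiplicity. Its mean is N^2 e, and on the event in question it vanishes.\<close>
  define W where "W = (\<lambda>(xs, ys). \<Sum>x\<leftarrow>xs. F x ys)"
  define n where "n = real N"
  have n: "n \<ge> 1" using N by (simp add: n_def)
  have hh: "(h x y)\<^sup>2 = h x y" for x y using h[of x y] by auto
  have h0: "0 \<le> h x y" for x y using h[of x y] by auto
  have E0: "0 \<le> ?E (h x)" "0 \<le> ?E (\<lambda>x. h x y)" for x y using h0 by auto
  have swap: "?E (\<lambda>y. ?E (\<lambda>x. h x y)) = e"
    unfolding e(1) by (rule pmf_expectation_swap[OF fin fin])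
  have sqL: "?E (\<lambda>x. (?E (h x))\<^sup>2) \<le> b * e"
  proof -
    have "?E (\<lambda>x. (?E (h x))\<^sup>2) \<le> ?E (\<lambda>x. b * ?E (h x))"
      using left E0 by (intro pmf_expectation_mono_finite[OF fin]) (simp add: power2_eq_square mult_right_mono)
    then show ?thesis by (simp add: e)
  qed
  have sqR: "?E (\<lambda>y. (?E (\<lambda>x. h x y))\<^sup>2) \<le> b * e"
  proof -
    have "?E (\<lambda>y. (?E (\<lambda>x. h x y))\<^sup>2) \<le> ?E (\<lambda>y. b * ?E (\<lambda>x. h x y))"
      using right E0 by (intro pmf_expectation_mono_finite[OF fin]) (simp add: power2_eq_square mult_right_mono)
    then show ?thesis by (simp add: swap)
  qed
  have EF: "?E (\<lambda>x. F x ys) = (\<Sum>y\<leftarrow>ys. ?E (\<lambda>x. h x y))" for ys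
    unfolding F_def by (induction ys) (simp_all add: add)
  have m1: "?ER (\<lambda>ys. ?ER (\<lambda>xs. W (xs, ys))) = n\<^sup>2 * e"
    by (simp add: W_def expectation_replicate_sum_list[OF fin] EF swap n_def power2_eq_square)
  have m2: "?ER (\<lambda>ys. ?ER (\<lambda>xs. (W (xs, ys))\<^sup>2)) \<le> n\<^sup>2 * e + 2 * n ^ 3 * b * e + n ^ 4 * e\<^sup>2"
  proof -
    \<comment> \<open>For fixed \<open>ys\<close>, \<open>W\<close> is a sum of independent terms
      \<open>F x ys\<close>. Both averages over \<open>ys\<close> that result from its square are
      again second moments of sums of independent terms.\<close>
    have inner: "?ER (\<lambda>xs. (W (xs, ys))\<^sup>2)
        = n * ?E (\<lambda>x. (F x ys)\<^sup>2) + n * (n - 1) * (\<Sum>y\<leftarrow>ys. ?E (\<lambda>x. h x y))\<^sup>2" for ys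
      by (simp add: W_def expectation_replicate_sum_list_square[OF fin] EF n_def)
    have "?ER (\<lambda>ys. ?E (\<lambda>x. (F x ys)\<^sup>2)) = ?E (\<lambda>x. ?ER (\<lambda>ys. (F x ys)\<^sup>2))"
      by (rule pmf_expectation_swap[OF finR fin])
    also have "\<dots> = n * e + n * (n - 1) * ?E (\<lambda>x. (?E (h x))\<^sup>2)"
      by (simp add: F_def expectation_replicate_sum_list_square[OF fin] hh n_def e add)
    also have "\<dots> \<le> n * e + n * (n - 1) * (b * e)"
      using sqL n by (intro add_left_mono mult_left_mono) auto
    finally have 1: "?ER (\<lambda>ys. ?E (\<lambda>x. (F x ys)\<^sup>2)) \<le> n * e + n * (n - 1) * (b * e)" .
    have "?ER (\<lambda>ys. (\<Sum>y\<leftarrow>ys. ?E (\<lambda>x. h x y))\<^sup>2)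
        = n * ?E (\<lambda>y. (?E (\<lambda>x. h x y))\<^sup>2) + n * (n - 1) * e\<^sup>2"
      by (simp add: expectation_replicate_sum_list_square[OF fin] swap n_def)
    also have "\<dots> \<le> n * (b * e) + n * (n - 1) * e\<^sup>2"
      using sqR n by (intro add_right_mono mult_left_mono) auto
    finally have 2: "?ER (\<lambda>ys. (\<Sum>y\<leftarrow>ys. ?E (\<lambda>x. h x y))\<^sup>2) \<le> n * (b * e) + n * (n - 1) * e\<^sup>2" .
    have b0: "0 \<le> b" using left[of undefined] E0(1)[of undefined] by linarith
    have "?ER (\<lambda>ys. ?ER (\<lambda>xs. (W (xs, ys))\<^sup>2))
        \<le> n * (n * e + n * (n - 1) * (b * e)) + n * (n - 1) * (n * (b * e) + n * (n - 1) * e\<^sup>2)"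
      unfolding inner using 1 2 n by (simp add: add) (intro add_mono mult_left_mono; simp)
    also have "\<dots> \<le> n * (n * e + n * n * (b * e)) + n * n * (n * (b * e) + n * n * e\<^sup>2)"
      using n b0 e by (intro add_mono mult_mono mult_nonneg_nonneg add_nonneg_nonneg order_refl) auto
    also have "\<dots> = n\<^sup>2 * e + 2 * n ^ 3 * b * e + n ^ 4 * e\<^sup>2"
      by (simp add: power2_eq_square power3_eq_cube power4_eq_xxxx algebra_simps)
    finally show ?thesis .
  qed
  define Q where "Q = pair_pmf ?R ?R"
  have finQ: "finite (set_pmf Q)" using finR by (simp add: Q_def)
  have EQ: "measure_pmf.expectation Q g = ?ER (\<lambda>ys. ?ER (\<lambda>xs. g (xs, ys)))" for g :: "_ \<Rightarrow> real"
  proof -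
    have "measure_pmf.expectation Q g = ?ER (\<lambda>xs. ?ER (\<lambda>ys. g (xs, ys)))"
      unfolding Q_def pair_pmf_def using finR by (simp add: pmf_expectation_bind_finite)
    also have "\<dots> = ?ER (\<lambda>ys. ?ER (\<lambda>xs. g (xs, ys)))" by (rule pmf_expectation_swap[OF finR finR])
    finally show ?thesis .
  qed
  let ?A = "{(xs, ys). \<forall>x\<in>set xs. \<forall>y\<in>set ys. h x y = 0}"
  have pos: "n\<^sup>2 * e > 0" using n e by simp
  have EW: "measure_pmf.expectation Q W = n\<^sup>2 * e" using m1 EQ[of W] by simp
  have "measure_pmf.prob Q ?A \<le> (measure_pmf.expectation Q (\<lambda>z. (W z)\<^sup>2) - (measure_pmf.expectation Q W)\<^sup>2) / (n\<^sup>2 * e)\<^sup>2"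
  proof (rule pmf_Chebyshev[OF finQ pos])
    fix z assume "z \<in> ?A"
    then obtain xs ys where z: "z = (xs, ys)" "\<forall>x\<in>set xs. \<forall>y\<in>set ys. h x y = 0" by auto
    have "F x ys = 0" if "x \<in> set xs" for x
    proof -
      have "map (h x) ys = map (\<lambda>_. 0) ys" using z that by (intro map_cong) auto
      then show ?thesis unfolding F_def by (simp only: sum_list_0)
    qed
    then have "map (\<lambda>x. F x ys) xs = map (\<lambda>_. 0) xs" by (intro map_cong) auto
    then have "W z = 0" unfolding W_def z(1) case_prod_conv by (simp only: sum_list_0)
    then show "n\<^sup>2 * e \<le> \<bar>W z - measure_pmf.expectation Q W\<bar>" using EW pos by simp
  qed
  \<comment> \<open>The term n^4 e^2 cancels against the squared mean; what is left comes from
    coinciding pairs and from pairs that share one element.\<close>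
  also have "\<dots> \<le> (n\<^sup>2 * e + 2 * n ^ 3 * b * e + n ^ 4 * e\<^sup>2 - (n\<^sup>2 * e)\<^sup>2) / (n\<^sup>2 * e)\<^sup>2"
    unfolding EQ[of "\<lambda>z. (W z)\<^sup>2"] EW using m2 by (intro divide_right_mono) auto
  also have "\<dots> = (n\<^sup>2 * e) * (1 + 2 * n * b) / (n\<^sup>2 * e)\<^sup>2"
    by (simp add: power2_eq_square power3_eq_cube power4_eq_xxxx algebra_simps)
  also have "\<dots> = (1 + 2 * n * b) / (n\<^sup>2 * e)" using pos by (simp add: power2_eq_square)
  finally have "measure_pmf.prob Q ?A \<le> (1 + 2 * n * b) / (n\<^sup>2 * e)" .
  moreover have "measure_pmf.prob Q ?A = ?ER (\<lambda>xs. measure_pmf.prob ?R {ys. \<forall>x\<in>set xs. \<forall>y\<in>set ys. h x y = 0})"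
  proof -
    have "measure_pmf.prob Q ?A = measure_pmf.expectation Q (indicat_real ?A)" by simp
    also have "\<dots> = ?ER (\<lambda>xs. ?ER (\<lambda>ys. indicat_real ?A (xs, ys)))"
      unfolding EQ by (rule pmf_expectation_swap[OF finR finR])
    also have "(\<lambda>xs. ?ER (\<lambda>ys. indicat_real ?A (xs, ys)))
        = (\<lambda>xs. ?ER (indicat_real {ys. \<forall>x\<in>set xs. \<forall>y\<in>set ys. h x y = 0}))"
      by (intro ext arg_cong[where f = "?ER"]) (auto simp: indicator_def)
    finally show ?thesis by simp
  qed
  ultimately show ?thesis by (simp add: n_def)
qed

section \<open>Degrees and random arcs\<close>

lemma nbrs_subset_verts: "simple_graph G \<Longrightarrow> nbrs G x \<subseteq> verts G"
  by (auto simp: simple_graph_def nbrs_def)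

lemma finite_nbrs: "simple_graph G \<Longrightarrow> finite (nbrs G x)"
  using nbrs_subset_verts[of G x] by (auto simp: simple_graph_def intro: finite_subset)

lemma finite_edges: assumes "simple_graph G" shows "finite (edges G)"
proof -
  have "edges G \<subseteq> Pow (verts G)" using assms by (auto simp: simple_graph_def)
  then show ?thesis using assms by (auto simp: simple_graph_def intro: finite_subset)
qed

abbreviation deg :: "graph \<Rightarrow> nat \<Rightarrow> nat" where "deg G x \<equiv> card (nbrs G x)"

abbreviation adj :: "graph \<Rightarrow> nat \<Rightarrow> nat \<Rightarrow> bool" where "adj G x y \<equiv> {x, y} \<in> edges G"

text \<open>Ties in degree are broken by the identifier, so that this is a strict total order on the
  labels of distinct vertices and directs every edge exactly once.\<close>

definition below :: "nat \<times> nat \<Rightarrow> nat \<times> nat \<Rightarrow> bool" where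
  "below = (\<lambda>(v, a) (u, b). a < b \<or> a = b \<and> v < u)"

definition weight :: "(nat \<times> nat) \<times> (nat \<times> nat) \<Rightarrow> nat" where
  "weight = (\<lambda>(x, y). if below x y then snd x else 0)"

text \<open>Sampled arcs carry degrees next to identifiers because this is all that the program
  learns; \<open>weight\<close>, \<open>heaviest\<close> and \<open>accept_test\<close> thus refer
  to no graph.\<close>

definition label :: "graph \<Rightarrow> nat \<Rightarrow> nat \<times> nat" where
  "label G v = (v, deg G v)"

definition arc_pmf :: "graph \<Rightarrow> ((nat \<times> nat) \<times> (nat \<times> nat)) pmf" where
  "arc_pmf G = bind_pmf (pmf_of_set (verts G))
     (\<lambda>v. map_pmf (\<lambda>u. (label G v, label G u)) (pmf_of_set (nbrs G v)))"

definition up_arcs :: "graph \<Rightarrow> (nat \<times> nat) set" where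
  "up_arcs G = {(v, u). adj G v u \<and> below (label G v) (label G u)}"

locale query_input =
  fixes G :: graph
  assumes input: "input_graph G"
begin

lemma simple: "simple_graph G" using input by (simp add: input_graph_def)

lemma finite_verts: "finite (verts G)" and verts_nonempty: "verts G \<noteq> {}"
  using simple by (auto simp: simple_graph_def)

lemma nbrs_nonempty: "x \<in> verts G \<Longrightarrow> nbrs G x \<noteq> {}"
  using input by (auto simp: input_graph_def no_isolated_def)

lemma deg_pos: "x \<in> verts G \<Longrightarrow> deg G x > 0"
  using nbrs_nonempty finite_nbrs[OF simple] by (simp add: card_gt_0_iff)

lemma adjD: assumes "adj G x y" shows "x \<in> verts G" "y \<in> verts G" "x \<noteq> y"
proof -
  have "{x, y} \<subseteq> verts G" "card {x, y} = 2" using assms simple by (auto simp: simple_graph_def)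
  then show "x \<in> verts G" "y \<in> verts G" "x \<noteq> y" by (auto simp: card_insert_if split: if_splits)
qed

lemma finite_up_arcs: "finite (up_arcs G)"
  by (rule finite_subset[of _ "verts G \<times> verts G"]) (auto simp: up_arcs_def finite_verts dest: adjD)

lemma card_up_arcs: "card (up_arcs G) = card (edges G)"
proof -
  have "bij_betw (\<lambda>(v, u). {v, u}) (up_arcs G) (edges G)"
    unfolding bij_betw_def
  proof
    show "inj_on (\<lambda>(v, u). {v, u}) (up_arcs G)"
      by (auto simp: inj_on_def up_arcs_def below_def label_def doubleton_eq_iff)
    show "(\<lambda>(v, u). {v, u}) ` up_arcs G = edges G"
    proof (intro equalityI subsetI)
      fix e assume e: "e \<in> edges G"
      then have "card e = 2" using simple by (simp add: simple_graph_def)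
      then obtain x y where xy: "e = {x, y}" "x \<noteq> y" by (auto simp: card_2_iff)
      have "below (label G x) (label G y) \<or> below (label G y) (label G x)"
        using xy(2) by (auto simp: below_def label_def)
      then have "(x, y) \<in> up_arcs G \<or> (y, x) \<in> up_arcs G"
        using e xy by (auto simp: up_arcs_def insert_commute)
      then show "e \<in> (\<lambda>(v, u). {v, u}) ` up_arcs G"
        using xy(1) by (auto simp: image_iff insert_commute)
    qed (auto simp: up_arcs_def)
  qed
  then show ?thesis by (rule bij_betw_same_card)
qed

text \<open>The ordered adjacent pairs are the arcs in \<open>up_arcs G\<close> and their reversals,
  and no arc is both since \<open>below\<close> is asymmetric.\<close>

lemma sum_deg: "(\<Sum>v\<in>verts G. deg G v) = 2 * card (edges G)"
proof -
  have "(\<Sum>v\<in>verts G. deg G v) = card (SIGMA v:verts G. nbrs G v)"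
    using finite_verts finite_nbrs[OF simple] by (simp add: card_SigmaI)
  also have "(SIGMA v:verts G. nbrs G v) = up_arcs G \<union> prod.swap ` up_arcs G"
  proof (intro equalityI subsetI)
    fix z assume "z \<in> (SIGMA v:verts G. nbrs G v)"
    then obtain x y where z: "z = (x, y)" and a: "adj G x y" by (auto simp: nbrs_def)
    have "below (label G x) (label G y) \<or> below (label G y) (label G x)"
      using adjD(3)[OF a] by (auto simp: below_def label_def)
    then have "(x, y) \<in> up_arcs G \<or> (y, x) \<in> up_arcs G"
      using a by (auto simp: up_arcs_def insert_commute)
    then show "z \<in> up_arcs G \<union> prod.swap ` up_arcs G"
      using image_eqI[of z prod.swap "(y, x)"] by (auto simp: z)
  next
    fix z assume "z \<in> up_arcs G \<union> prod.swap ` up_arcs G"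
    then obtain x y where "z = (x, y)" "adj G x y" by (auto simp: up_arcs_def insert_commute)
    then show "z \<in> (SIGMA v:verts G. nbrs G v)" using adjD by (auto simp: nbrs_def)
  qed
  also have "card (up_arcs G \<union> prod.swap ` up_arcs G) = card (up_arcs G) + card (prod.swap ` up_arcs G)"
    using finite_up_arcs by (intro card_Un_disjoint) (auto simp: up_arcs_def below_def label_def)
  also have "card (prod.swap ` up_arcs G) = card (up_arcs G)" by (rule card_image) (auto simp: inj_on_def)
  finally show ?thesis by (simp add: card_up_arcs)
qed

abbreviation "n \<equiv> real (card (verts G))"
abbreviation "d \<equiv> avg_degree G"

lemma n_pos: "n > 0" using finite_verts verts_nonempty by (simp add: card_gt_0_iff)

lemma n_times_d: "n * d = 2 * real (card (edges G))"
  using n_pos by (simp add: avg_degree_def)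

text \<open>Without isolated vertices every degree is at least 1.\<close>

lemma d_ge_1: "d \<ge> 1"
proof -
  have "(\<Sum>v\<in>verts G. 1) \<le> (\<Sum>v\<in>verts G. deg G v)"
    using deg_pos by (intro sum_mono) (simp add: Suc_le_eq)
  then have "n \<le> 2 * real (card (edges G))" unfolding sum_deg by simp
  then show ?thesis using n_pos by (simp add: avg_degree_def)
qed

lemma d_le_n: "d \<le> n"
proof -
  have "2 * card (edges G) = (\<Sum>v\<in>verts G. deg G v)" by (simp add: sum_deg)
  also have "\<dots> \<le> (\<Sum>v\<in>verts G. card (verts G))"
    using nbrs_subset_verts[OF simple] finite_verts by (intro sum_mono card_mono) auto
  also have "\<dots> = card (verts G) * card (verts G)" by simp
  finally have "real (2 * card (edges G)) \<le> real (card (verts G) * card (verts G))"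
    by (simp only: of_nat_le_iff)
  then have "n * d \<le> n * n" unfolding n_times_d by simp
  then show ?thesis using n_pos by simp
qed

lemma sqrt_n_over_d_ge_1: "sqrt (n / d) \<ge> 1"
  using d_le_n d_ge_1 by simp

text \<open>If k neighbors of \<open>v\<close> are above it, each of them has degree at least deg v,
  hence at least k; so k^2 is at most the sum of all degrees, which is n d.\<close>

lemma up_degree_le:
  "real (card {u \<in> nbrs G v. below (label G v) (label G u)}) \<le> sqrt (n * d)"
proof -
  let ?U = "{u \<in> nbrs G v. below (label G v) (label G u)}"
  have "card ?U \<le> deg G u" if "u \<in> ?U" for u
  proof -
    have "card ?U \<le> deg G v" using finite_nbrs[OF simple] by (intro card_mono) auto
    also have "\<dots> \<le> deg G u" using that by (auto simp: below_def label_def)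
    finally show ?thesis .
  qed
  then have "card ?U * card ?U \<le> (\<Sum>u\<in>?U. deg G u)"
    using sum_mono[of ?U "\<lambda>_. card ?U" "deg G"] by simp
  also have "\<dots> \<le> (\<Sum>u\<in>verts G. deg G u)"
    using nbrs_subset_verts[OF simple, of v] finite_verts by (intro sum_mono2) auto
  finally have "card ?U * card ?U \<le> 2 * card (edges G)" by (simp add: sum_deg)
  then have "real (card ?U * card ?U) \<le> real (2 * card (edges G))" by (simp only: of_nat_le_iff)
  then have "(real (card ?U))\<^sup>2 \<le> n * d" by (simp add: n_times_d power2_eq_square)
  then show ?thesis by (rule real_le_rsqrt)
qed

section \<open>Moments of the weight of a random arc\<close>

lemma finite_set_arc_pmf: "finite (set_pmf (arc_pmf G))"
  using finite_verts verts_nonempty finite_nbrs[OF simple] nbrs_nonempty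
  by (auto simp: arc_pmf_def set_pmf_of_set)

lemma set_arc_pmf:
  assumes "x \<in> set_pmf (arc_pmf G)"
  obtains v u where "x = (label G v, label G u)" "adj G v u"
  using assms finite_verts verts_nonempty finite_nbrs[OF simple] nbrs_nonempty
  by (auto simp: arc_pmf_def set_pmf_of_set nbrs_def)

lemma expectation_arc_pmf:
  fixes f :: "_ \<Rightarrow> real"
  shows "measure_pmf.expectation (arc_pmf G) f
    = (\<Sum>v\<in>verts G. (\<Sum>u\<in>nbrs G v. f (label G v, label G u)) / deg G v) / n"
proof -
  have "measure_pmf.expectation (arc_pmf G) f = measure_pmf.expectation (pmf_of_set (verts G))
     (\<lambda>v. measure_pmf.expectation (pmf_of_set (nbrs G v)) (\<lambda>u. f (label G v, label G u)))"
    unfolding arc_pmf_def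
    using finite_verts verts_nonempty finite_nbrs[OF simple] nbrs_nonempty
    by (subst pmf_expectation_bind_finite) (auto simp: set_pmf_of_set)
  also have "\<dots> = (\<Sum>v\<in>verts G. measure_pmf.expectation (pmf_of_set (nbrs G v)) (\<lambda>u. f (label G v, label G u))) / n"
    by (rule integral_pmf_of_set[OF verts_nonempty finite_verts])
  also have "\<dots> = (\<Sum>v\<in>verts G. (\<Sum>u\<in>nbrs G v. f (label G v, label G u)) / deg G v) / n"
    using nbrs_nonempty finite_nbrs[OF simple]
    by (intro arg_cong2[where f = "(/)"] sum.cong refl) (simp add: integral_pmf_of_set)
  finally show ?thesis .
qed

text \<open>The value deg v cancels the probability 1 / deg v of the chosen neighbor, so every arc
  in \<open>up_arcs G\<close> contributes 1 / n. The predicate is there to single out heads of large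
  degree.\<close>

lemma expectation_weight:
  "measure_pmf.expectation (arc_pmf G) (\<lambda>x. real (weight x) * of_bool (P (snd (snd x))))
    = card {(v, u) \<in> up_arcs G. P (deg G u)} / n"
proof -
  have "(\<Sum>u\<in>nbrs G v. real (weight (label G v, label G u)) * of_bool (P (snd (label G u)))) / deg G v
     = card {u \<in> nbrs G v. below (label G v) (label G u) \<and> P (deg G u)}" if "v \<in> verts G" for v
  proof -
    have "(\<Sum>u\<in>nbrs G v. real (weight (label G v, label G u)) * of_bool (P (snd (label G u))))
      = (\<Sum>u\<in>nbrs G v. real (deg G v) * of_bool (below (label G v) (label G u) \<and> P (deg G u)))"
      by (intro sum.cong) (auto simp: weight_def label_def)
    also have "\<dots> = deg G v * real (card {u \<in> nbrs G v. below (label G v) (label G u) \<and> P (deg G u)})"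
      using finite_nbrs[OF simple] by (simp add: sum_distrib_left[symmetric] Int_def del: of_bool_conj)
    finally show ?thesis using deg_pos[OF that] by simp
  qed
  then have "measure_pmf.expectation (arc_pmf G) (\<lambda>x. real (weight x) * of_bool (P (snd (snd x))))
     = real (\<Sum>v\<in>verts G. card {u \<in> nbrs G v. below (label G v) (label G u) \<and> P (deg G u)}) / n"
    by (simp add: expectation_arc_pmf)
  also have "(\<Sum>v\<in>verts G. card {u \<in> nbrs G v. below (label G v) (label G u) \<and> P (deg G u)})
     = card (SIGMA v:verts G. {u \<in> nbrs G v. below (label G v) (label G u) \<and> P (deg G u)})"
    using finite_verts finite_nbrs[OF simple] by (simp add: card_SigmaI)
  also have "(SIGMA v:verts G. {u \<in> nbrs G v. below (label G v) (label G u) \<and> P (deg G u)})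
     = {(v, u) \<in> up_arcs G. P (deg G u)}"
    using adjD by (auto simp: up_arcs_def nbrs_def)
  finally show ?thesis .
qed

lemma expectation_weight_total: "measure_pmf.expectation (arc_pmf G) (\<lambda>x. real (weight x)) = d / 2"
  using expectation_weight[of "\<lambda>_. True"] n_pos by (simp add: card_up_arcs avg_degree_def)

text \<open>One factor deg v cancels as in the mean. At most sqrt (n d) neighbors are above v, and
  the remaining factor deg v averages to d.\<close>

lemma expectation_weight_square:
  "measure_pmf.expectation (arc_pmf G) (\<lambda>x. (real (weight x))\<^sup>2) \<le> sqrt (n * d) * d"
proof -
  have "(\<Sum>u\<in>nbrs G v. (real (weight (label G v, label G u)))\<^sup>2) / deg G v \<le> sqrt (n * d) * deg G v"
    if "v \<in> verts G" for v
  proof -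
    have "(\<Sum>u\<in>nbrs G v. (real (weight (label G v, label G u)))\<^sup>2)
      = (\<Sum>u\<in>nbrs G v. (real (deg G v))\<^sup>2 * of_bool (below (label G v) (label G u)))"
      by (intro sum.cong) (auto simp: weight_def label_def)
    also have "\<dots> = (real (deg G v))\<^sup>2 * card {u \<in> nbrs G v. below (label G v) (label G u)}"
      using finite_nbrs[OF simple] by (simp add: sum_distrib_left[symmetric] Int_def)
    also have "\<dots> \<le> (real (deg G v))\<^sup>2 * sqrt (n * d)"
      by (intro mult_left_mono up_degree_le) simp
    finally show ?thesis using deg_pos[OF that] by (simp add: divide_le_eq power2_eq_square mult_ac)
  qed
  then have "measure_pmf.expectation (arc_pmf G) (\<lambda>x. (real (weight x))\<^sup>2)
      \<le> (\<Sum>v\<in>verts G. sqrt (n * d) * deg G v) / n"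
    unfolding expectation_arc_pmf by (intro divide_right_mono sum_mono) auto
  also have "\<dots> = sqrt (n * d) * (real (\<Sum>v\<in>verts G. deg G v) / n)"
    by (simp add: sum_distrib_left)
  also have "\<dots> = sqrt (n * d) * d" by (simp add: sum_deg avg_degree_def)
  finally show ?thesis .
qed

lemma expectation_vertex:
  fixes f :: "nat \<Rightarrow> real"
  shows "measure_pmf.expectation (pmf_of_set (verts G)) f = (\<Sum>v\<in>verts G. f v) / n"
  by (rule integral_pmf_of_set[OF verts_nonempty finite_verts])

lemma expectation_adj:
  "measure_pmf.expectation (pmf_of_set (verts G)) (\<lambda>x. of_bool (adj G x y)) = deg G y / n"
proof -
  have "{x \<in> verts G. adj G x y} = nbrs G y"
    using adjD by (auto simp: nbrs_def insert_commute)
  then show ?thesis using finite_verts by (simp add: expectation_vertex Int_def)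
qed

lemma finite_set_vertex: "finite (set_pmf (pmf_of_set (verts G)))"
  using finite_verts verts_nonempty by (simp add: set_pmf_of_set)

end

section \<open>The stopping test\<close>

text \<open>Pairs of positions are counted, with repetitions, whereas \<open>Additive\<close> counts
  distinct edges. The mean of this count obeys a simple recursion, and the count is at least 1
  whenever the sample spans an edge.\<close>

fun adjacent_pairs :: "graph \<Rightarrow> nat list \<Rightarrow> real" where
  "adjacent_pairs G [] = 0"
| "adjacent_pairs G (x # xs) = (\<Sum>y\<leftarrow>xs. of_bool (adj G y x)) + adjacent_pairs G xs"

definition heaviest :: "((nat \<times> nat) \<times> (nat \<times> nat)) list \<Rightarrow> nat \<times> nat" where
  "heaviest E = last (sort_key snd (map snd E))"

text \<open>The second disjunct says that the quotient of \<open>c\<close> times the total weight by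
  the degree of the heaviest head is at least 1; clearing the denominator leaves a test on natural
  numbers.\<close>

definition accept_test :: "nat \<Rightarrow> nat \<Rightarrow> ((nat \<times> nat) \<times> (nat \<times> nat)) list \<Rightarrow> bool" where
  "accept_test a c E \<longleftrightarrow> 1 \<le> a \<or> snd (heaviest E) \<le> c * (\<Sum>x\<leftarrow>E. weight x)"

text \<open>The test with the true answers of the \<open>Additive\<close> queries filled in. A pair
  spans at most one edge, so each summand is an adjacency indicator.\<close>

definition accepts :: "graph \<Rightarrow> nat list \<Rightarrow> nat list \<Rightarrow> ((nat \<times> nat) \<times> (nat \<times> nat)) list \<Rightarrow> bool" where
  "accepts G S T E \<longleftrightarrow> accept_test (card {e \<in> edges G. e \<subseteq> set S \<union> set T})
     (\<Sum>s\<leftarrow>S. card {e \<in> edges G. e \<subseteq> {fst (heaviest E), s}}) E"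

lemma pmf_expectation_const: "measure_pmf.expectation p (\<lambda>_. c :: real) = c"
  by simp

lemma heaviest:
  assumes "E \<noteq> []"
  shows "heaviest E \<in> snd ` set E" "x \<in> set E \<Longrightarrow> snd (snd x) \<le> snd (heaviest E)"
proof -
  let ?L = "sort_key snd (map snd E)"
  have ne: "?L \<noteq> []" using assms by (metis length_0_conv length_map length_sort)
  show "heaviest E \<in> snd ` set E"
    using last_in_set[OF ne] by (simp add: heaviest_def)
  assume "x \<in> set E"
  then have "snd x \<in> set ?L" by simp
  then obtain i where i: "i < length ?L" "?L ! i = snd x" by (metis in_set_conv_nth)
  have "sorted (map snd ?L)" by simp
  then have "map snd ?L ! i \<le> map snd ?L ! (length ?L - 1)"
    using i(1) by (intro sorted_nth_mono) auto
  then show "snd (snd x) \<le> snd (heaviest E)"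
    using i ne by (simp add: heaviest_def last_conv_nth)
qed

lemma adjacent_pairs_nonneg: "0 \<le> adjacent_pairs G xs"
  by (induction xs) (auto intro!: add_nonneg_nonneg sum_list_nonneg)

lemma sum_list_ge_member: "x \<in> set xs \<Longrightarrow> (\<And>y. 0 \<le> f y) \<Longrightarrow> (f x :: real) \<le> (\<Sum>y\<leftarrow>xs. f y)"
proof (induction xs)
  case (Cons a xs)
  have "0 \<le> (\<Sum>y\<leftarrow>xs. f y)" using Cons by (auto intro!: sum_list_nonneg)
  then show ?case using Cons by (fastforce intro: add_increasing)
qed simp

lemma adjacent_pairs_ge_1:
  assumes "x \<in> set xs" "y \<in> set xs" "adj G x y" "x \<noteq> y"
  shows "1 \<le> adjacent_pairs G xs"
  using assms
proof (induction xs)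
  case (Cons a xs)
  let ?s = "\<Sum>y\<leftarrow>xs. of_bool (adj G y a) :: real"
  have s0: "0 \<le> ?s" by (auto intro!: sum_list_nonneg)
  have mem: "1 \<le> ?s" if "z \<in> set xs" "adj G z a" for z
    using sum_list_ge_member[of z xs "\<lambda>y. of_bool (adj G y a)"] that by simp
  consider "x = a" "y \<in> set xs" | "y = a" "x \<in> set xs" | "x \<in> set xs" "y \<in> set xs"
    using Cons.prems by auto
  then show ?case
  proof cases
    case 1
    then show ?thesis using mem[of y] Cons.prems adjacent_pairs_nonneg[of G xs] by (simp add: insert_commute)
  next
    case 2
    then show ?thesis using mem[of x] Cons.prems adjacent_pairs_nonneg[of G xs] by simp
  next
    case 3
    then show ?thesis using Cons s0 by simp
  qed
qed simp

context query_input
begin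

abbreviation "rand_vert \<equiv> pmf_of_set (verts G)"
abbreviation "rand_verts q \<equiv> replicate_pmf q rand_vert"
abbreviation "rand_arcs q \<equiv> replicate_pmf q (arc_pmf G)"

lemma finite_set_rand_verts: "finite (set_pmf (rand_verts q))"
  by (rule finite_set_replicate_pmf[OF finite_set_vertex])

lemma finite_set_rand_arcs: "finite (set_pmf (rand_arcs q))"
  by (rule finite_set_replicate_pmf[OF finite_set_arc_pmf])

lemma edges_within_pair: "card {e \<in> edges G. e \<subseteq> {u, s}} = of_bool (adj G s u)"
proof -
  have "{e \<in> edges G. e \<subseteq> {u, s}} = (if adj G s u then {{s, u}} else {})"
  proof -
    have "e = {s, u}" if "e \<in> edges G" "e \<subseteq> {u, s}" for e
    proof -
      have "card e = 2" using that simple by (auto simp: simple_graph_def)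
      moreover have "card {s, u} \<le> 2" by (simp add: card_insert_if)
      ultimately show ?thesis using card_subset_eq[of "{s, u}" e] card_mono[of "{s, u}" e] that
        by (auto simp: insert_commute)
    qed
    then show ?thesis by (cases "adj G s u") (auto simp: insert_commute)
  qed
  then show ?thesis by (cases "adj G s u") simp_all
qed

lemma edges_within_pos:
  "1 \<le> card {e \<in> edges G. e \<subseteq> X} \<longleftrightarrow> (\<exists>x\<in>X. \<exists>y\<in>X. adj G x y)"
proof -
  have "finite {e \<in> edges G. e \<subseteq> X}" using finite_edges[OF simple] by simp
  then have "1 \<le> card {e \<in> edges G. e \<subseteq> X} \<longleftrightarrow> {e \<in> edges G. e \<subseteq> X} \<noteq> {}"
    by (simp add: Suc_le_eq card_gt_0_iff)
  also have "\<dots> \<longleftrightarrow> (\<exists>x\<in>X. \<exists>y\<in>X. adj G x y)"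
  proof
    assume "{e \<in> edges G. e \<subseteq> X} \<noteq> {}"
    then obtain e where e: "e \<in> edges G" "e \<subseteq> X" by blast
    then have "card e = 2" using simple by (auto simp: simple_graph_def)
    then show "\<exists>x\<in>X. \<exists>y\<in>X. adj G x y" using e by (auto simp: card_2_iff)
  qed auto
  finally show ?thesis .
qed

section \<open>Upper bound on the acceptance probability\<close>

text \<open>Each of the q (q - 1) / 2 pairs of positions is adjacent with probability d / n.\<close>

lemma expectation_adjacent_pairs:
  "measure_pmf.expectation (rand_verts q) (adjacent_pairs G) \<le> (real q)\<^sup>2 / 2 * (d / n)"
proof (induction q)
  case (Suc q)
  have deg: "measure_pmf.expectation rand_vert (\<lambda>x. real (deg G x) / n) = d / n"
    using n_pos by (simp add: expectation_vertex sum_divide_distrib[symmetric] avg_degree_def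
      flip: of_nat_sum) (simp add: sum_deg)
  have "measure_pmf.expectation (rand_verts (Suc q)) (adjacent_pairs G)
      = measure_pmf.expectation rand_vert (\<lambda>x. real q * (real (deg G x) / n))
        + measure_pmf.expectation (rand_verts q) (adjacent_pairs G)"
    by (simp add: expectation_replicate_pmf_Suc[OF finite_set_vertex] pmf_expectation_add
      finite_set_rand_verts finite_set_vertex expectation_replicate_sum_list expectation_adj
      del: replicate_pmf.simps)
  also have "\<dots> = real q * (d / n) + measure_pmf.expectation (rand_verts q) (adjacent_pairs G)"
    by (simp only: deg integral_mult_right_zero)
  also have "\<dots> \<le> real q * (d / n) + (real q)\<^sup>2 / 2 * (d / n)" using Suc by simp
  also have "\<dots> \<le> (real (Suc q))\<^sup>2 / 2 * (d / n)"
  proof -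
    have "(real q + (real q)\<^sup>2 / 2) * (d / n) \<le> (real (Suc q))\<^sup>2 / 2 * (d / n)"
      using d_ge_1 n_pos by (intro mult_right_mono) (auto simp: power2_eq_square algebra_simps)
    then show ?thesis by (simp only: distrib_right)
  qed
  finally show ?case .
qed simp

definition accept_prob :: "nat \<Rightarrow> real" where
  "accept_prob q = measure_pmf.expectation (rand_verts q) (\<lambda>S.
     measure_pmf.expectation (rand_verts q) (\<lambda>T.
       measure_pmf.expectation (rand_arcs q) (\<lambda>E. of_bool (accepts G S T E))))"

lemma expectation_adj_count:
  "measure_pmf.expectation (rand_verts q) (\<lambda>S. \<Sum>s\<leftarrow>S. of_bool (adj G s u)) = real q * (deg G u / n)"
  by (simp add: expectation_replicate_sum_list[OF finite_set_vertex] expectation_adj)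

lemma set_rand_arcs_heaviest:
  assumes "E \<in> set_pmf (rand_arcs q)" "q > 0"
  obtains u where "heaviest E = (u, deg G u)" "deg G u > 0"
proof -
  have "E \<noteq> []" "set E \<subseteq> set_pmf (arc_pmf G)" using assms by (auto simp: set_replicate_pmf)
  then obtain x where x: "x \<in> set_pmf (arc_pmf G)" "heaviest E = snd x"
    using heaviest(1) by blast
  obtain v u where vu: "x = (label G v, label G u)" "adj G v u" using set_arc_pmf[OF x(1)] by blast
  show ?thesis using that[of u] x(2) vu deg_pos adjD by (auto simp: label_def)
qed

lemma accepts_iff:
  "accepts G S T E \<longleftrightarrow> (\<exists>x\<in>set (S @ T). \<exists>y\<in>set (S @ T). adj G x y) \<or>
     real (snd (heaviest E)) \<le> (\<Sum>s\<leftarrow>S. of_bool (adj G s (fst (heaviest E)))) * (\<Sum>x\<leftarrow>E. real (weight x))"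
proof -
  have 1: "(\<Sum>x\<leftarrow>E. real (weight x)) = real (\<Sum>x\<leftarrow>E. weight x)" by (induction E) auto
  have 2: "(\<Sum>s\<leftarrow>S. of_bool (adj G s u) :: real) = real (\<Sum>s\<leftarrow>S. of_bool (adj G s u))" for u
    by (induction S) auto
  show ?thesis
    unfolding accepts_def accept_test_def edges_within_pos edges_within_pair 1 2
    by (simp only: of_nat_le_iff of_nat_mult[symmetric] set_append)
qed

text \<open>If the test accepts, \<open>adjacent_pairs\<close> or the quotient \<open>f\<close> is
  at least 1, so the probability is at most the sum of their means.\<close>

lemma accept_prob_le:
  assumes q: "q > 0"
  shows "accept_prob q \<le> 5 / 2 * (real q)\<^sup>2 * (d / n)"
proof -
  let ?V = "measure_pmf.expectation (rand_verts q)" and ?A = "measure_pmf.expectation (rand_arcs q)"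
  define f where "f S E = (\<Sum>s\<leftarrow>S. of_bool (adj G s (fst (heaviest E)))) * (\<Sum>x\<leftarrow>E. real (weight x))
    / real (snd (heaviest E))" for S E
  have f0: "0 \<le> f S E" for S E
    unfolding f_def by (intro divide_nonneg_nonneg mult_nonneg_nonneg sum_list_nonneg) auto
  note fin = finite_set_rand_verts finite_set_rand_arcs
  have le: "of_bool (accepts G S T E) \<le> adjacent_pairs G (S @ T) + f S E"
    if E: "E \<in> set_pmf (rand_arcs q)" for S T E
  proof (cases "accepts G S T E")
    case True
    then consider x y where "x \<in> set (S @ T)" "y \<in> set (S @ T)" "adj G x y"
      | "real (snd (heaviest E)) \<le> (\<Sum>s\<leftarrow>S. of_bool (adj G s (fst (heaviest E)))) * (\<Sum>x\<leftarrow>E. real (weight x))"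
      unfolding accepts_iff by blast
    then show ?thesis
    proof cases
      case 1
      then have "1 \<le> adjacent_pairs G (S @ T)" using adjD(3) by (intro adjacent_pairs_ge_1) auto
      then show ?thesis using f0[of S E] by simp
    next
      case 2
      obtain u where "heaviest E = (u, deg G u)" "deg G u > 0" using set_rand_arcs_heaviest[OF E q] .
      then have "1 \<le> f S E" using 2 by (simp add: f_def)
      then show ?thesis using adjacent_pairs_nonneg[of G "S @ T"] by simp
    qed
  qed (simp add: f0 adjacent_pairs_nonneg)
  have "accept_prob q \<le> ?V (\<lambda>S. ?V (\<lambda>T. ?A (\<lambda>E. adjacent_pairs G (S @ T) + f S E)))"
    unfolding accept_prob_def by (intro pmf_expectation_mono_finite fin le)
  also have "\<dots> = ?V (\<lambda>S. ?V (\<lambda>T. adjacent_pairs G (S @ T))) + ?V (\<lambda>S. ?A (f S))"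
    by (simp add: pmf_expectation_add fin)
  \<comment> \<open>Two independent samples of size q form one of size 2q, whence a term (2q)^2 / 2;
    with q^2 / 2 from \<open>f\<close> this gives the constant 5 / 2.\<close>
  also have "?V (\<lambda>S. ?V (\<lambda>T. adjacent_pairs G (S @ T)))
      = measure_pmf.expectation (rand_verts (q + q)) (adjacent_pairs G)"
    by (simp add: replicate_pmf_distrib pmf_expectation_bind_finite fin)
  also have "\<dots> \<le> (real (q + q))\<^sup>2 / 2 * (d / n)" by (rule expectation_adjacent_pairs)
  also have "?V (\<lambda>S. ?A (f S)) = ?A (\<lambda>E. ?V (\<lambda>S. f S E))"
    by (rule pmf_expectation_swap[OF fin])
  \<comment> \<open>Once \<open>E\<close> is fixed, so is its heaviest head u, and the expected
    number q deg u / n of samples adjacent to it cancels the denominator deg u.\<close>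
  also have "\<dots> = ?A (\<lambda>E. real q / n * (\<Sum>x\<leftarrow>E. real (weight x)))"
  proof (rule pmf_expectation_cong)
    fix E assume E: "E \<in> set_pmf (rand_arcs q)"
    obtain u where u: "heaviest E = (u, deg G u)" "deg G u > 0" using set_rand_arcs_heaviest[OF E q] .
    have "?V (\<lambda>S. f S E) = ?V (\<lambda>S. \<Sum>s\<leftarrow>S. of_bool (adj G s u)) * (\<Sum>x\<leftarrow>E. real (weight x)) / deg G u"
      by (simp add: f_def u)
    also have "\<dots> = real q / n * (\<Sum>x\<leftarrow>E. real (weight x))"
      using u(2) by (simp only: expectation_adj_count) simp
    finally show "?V (\<lambda>S. f S E) = real q / n * (\<Sum>x\<leftarrow>E. real (weight x))" .
  qed
  also have "\<dots> = real q / n * (real q * (d / 2))"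
    by (simp add: expectation_replicate_sum_list[OF finite_set_arc_pmf] expectation_weight_total)
  finally show ?thesis by (simp add: power2_eq_square algebra_simps add_divide_distrib)
qed

section \<open>Rejection probability for large samples\<close>

lemma not_accept_prob:
  "1 - accept_prob q = measure_pmf.expectation (rand_verts q) (\<lambda>S.
     measure_pmf.expectation (rand_verts q) (\<lambda>T.
       measure_pmf.expectation (rand_arcs q) (\<lambda>E. of_bool (\<not> accepts G S T E))))"
proof -
  have compl: "measure_pmf.expectation p (\<lambda>x. 1 - f x) = 1 - measure_pmf.expectation p f"
    if "finite (set_pmf p)" for p :: "'b pmf" and f :: "'b \<Rightarrow> real"
    using that by (simp add: Bochner_Integration.integral_diff integrable_measure_pmf_finite)
  show ?thesis
    unfolding accept_prob_def of_bool_not_iff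
    by (simp only: compl[OF finite_set_rand_verts] compl[OF finite_set_rand_arcs])
qed

text \<open>Second moment method for the arcs with a head of degree below \<theta>, with the tail
  found in \<open>S\<close> and the head in \<open>T\<close>. Their tails have no larger degree, so
  a vertex is related to at most \<theta> others on either side.\<close>

lemma not_accept_prob_light:
  assumes q: "q > 0" and \<theta>: "\<theta> > 0"
    and light: "real (card (edges G)) / 2 \<le> card {(v, u) \<in> up_arcs G. real (deg G u) < \<theta>}"
  shows "1 - accept_prob q \<le> 4 * (1 + 2 * real q * (\<theta> / n)) / ((real q)\<^sup>2 * (d / n))"
proof -
  let ?V = "measure_pmf.expectation (rand_verts q)"
  let ?E = "measure_pmf.expectation rand_vert"
  define L where "L = {(v, u) \<in> up_arcs G. real (deg G u) < \<theta>}"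
  define h :: "nat \<Rightarrow> nat \<Rightarrow> real" where "h x y = of_bool ((x, y) \<in> L)" for x y
  have Lsub: "L \<subseteq> verts G \<times> verts G" using adjD by (auto simp: L_def up_arcs_def)
  \<comment> \<open>Serves both directions: \<open>x\<close> has degree below \<theta> if it is the
    tail of such an arc, being below the head, as well as if it is the head.\<close>
  have card_le: "?E f \<le> \<theta> / n" if f: "\<And>y. f y = of_bool (y \<in> X)" and X: "X \<subseteq> nbrs G x" "X \<noteq> {} \<Longrightarrow> deg G x < \<theta>" for f X x
  proof -
    have XV: "X \<subseteq> verts G" using X(1) nbrs_subset_verts[OF simple] by blast
    have "?E f = real (card X) / n"
      using XV finite_verts by (simp add: expectation_vertex f Int_absorb1)
    also have "card X \<le> deg G x" using X(1) finite_nbrs[OF simple] by (intro card_mono)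
    then have "real (card X) \<le> \<theta>" using X(2) \<theta> by (cases "X = {}") auto
    then have "real (card X) / n \<le> \<theta> / n" using n_pos by (intro divide_right_mono) auto
    finally show ?thesis .
  qed
  define e where "e = ?E (\<lambda>x. ?E (h x))"
  have e: "e = real (card L) / n\<^sup>2"
  proof -
    have "e = (\<Sum>x\<in>verts G. \<Sum>y\<in>verts G. h x y) / n\<^sup>2"
      by (simp add: e_def expectation_vertex sum_divide_distrib[symmetric] power2_eq_square)
    also have "(\<Sum>x\<in>verts G. \<Sum>y\<in>verts G. h x y) = (\<Sum>z\<in>verts G \<times> verts G. of_bool (z \<in> L))"
      by (simp add: sum.cartesian_product h_def case_prod_unfold)
    also have "\<dots> = real (card L)"
      using Lsub finite_verts by (simp add: Int_absorb1)
    finally show ?thesis .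
  qed
  have "real (card (edges G)) / 2 / n\<^sup>2 \<le> e"
    unfolding e using light by (intro divide_right_mono) (auto simp: L_def)
  moreover have "real (card (edges G)) / 2 / n\<^sup>2 = d / n / 4"
    by (simp add: avg_degree_def power2_eq_square)
  ultimately have e4: "d / n / 4 \<le> e" by simp
  have dn: "d / n > 0" using d_ge_1 n_pos by simp
  have "1 - accept_prob q \<le> ?V (\<lambda>S. ?V (\<lambda>T. of_bool (\<forall>x\<in>set S. \<forall>y\<in>set T. h x y = 0)))"
    unfolding not_accept_prob
  proof (intro pmf_expectation_mono_finite finite_set_rand_verts)
    fix S T
    have "of_bool (\<not> accepts G S T E) \<le> (of_bool (\<forall>x\<in>set S. \<forall>y\<in>set T. h x y = 0) :: real)" for E
      by (auto simp: accepts_iff h_def L_def up_arcs_def)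
    then have "measure_pmf.expectation (rand_arcs q) (\<lambda>E. of_bool (\<not> accepts G S T E))
       \<le> measure_pmf.expectation (rand_arcs q) (\<lambda>E. of_bool (\<forall>x\<in>set S. \<forall>y\<in>set T. h x y = 0) :: real)"
      by (intro pmf_expectation_mono_finite finite_set_rand_arcs)
    then show "measure_pmf.expectation (rand_arcs q) (\<lambda>E. of_bool (\<not> accepts G S T E))
       \<le> (of_bool (\<forall>x\<in>set S. \<forall>y\<in>set T. h x y = 0) :: real)" by simp
  qed
  also have "\<dots> = ?V (\<lambda>S. measure_pmf.prob (rand_verts q) {T. \<forall>x\<in>set S. \<forall>y\<in>set T. h x y = 0})"
  proof (rule arg_cong[where f = ?V], rule ext)
    fix S
    have "(\<lambda>T. of_bool (\<forall>x\<in>set S. \<forall>y\<in>set T. h x y = 0))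
        = indicat_real {T. \<forall>x\<in>set S. \<forall>y\<in>set T. h x y = 0}"
      by (auto simp: indicator_def)
    then show "?V (\<lambda>T. of_bool (\<forall>x\<in>set S. \<forall>y\<in>set T. h x y = 0))
        = measure_pmf.prob (rand_verts q) {T. \<forall>x\<in>set S. \<forall>y\<in>set T. h x y = 0}" by simp
  qed
  also have "\<dots> \<le> (1 + 2 * real q * (\<theta> / n)) / ((real q)\<^sup>2 * e)"
  proof (rule no_related_pair_prob_le[OF finite_set_vertex q])
    show "?E (h x) \<le> \<theta> / n" for x
      by (rule card_le[of _ "{y. (x, y) \<in> L}" x])
        (auto simp: h_def L_def up_arcs_def nbrs_def below_def label_def)
    show "?E (\<lambda>x. h x y) \<le> \<theta> / n" for y
      by (rule card_le[of _ "{x. (x, y) \<in> L}" y])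
        (auto simp: h_def L_def up_arcs_def nbrs_def insert_commute)
    have "0 < d / n / 4" using dn by simp
    then show "0 < e" using e4 by (rule less_le_trans)
    show "e = ?E (\<lambda>x. ?E (h x))" by (rule e_def)
  qed (auto simp: h_def)
  also have "\<dots> \<le> (1 + 2 * real q * (\<theta> / n)) / ((real q)\<^sup>2 * (d / n / 4))"
    using e4 dn q \<theta> n_pos by (intro divide_left_mono mult_left_mono mult_pos_pos add_nonneg_nonneg) auto
  also have "\<dots> = 4 * (1 + 2 * real q * (\<theta> / n)) / ((real q)\<^sup>2 * (d / n))"
  proof -
    have "a / (b * (c / 4)) = 4 * a / (b * c)" for a b c :: real by simp
    then show ?thesis .
  qed
  finally show ?thesis .
qed

text \<open>Unless the weight on heavy heads falls below half its mean (\<open>B1\<close>), it is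
  positive, so some sampled head is heavy and hence so is the heaviest one, u. Unless also the
  number of samples adjacent to u falls below half its mean (\<open>C u\<close>), its product with
  the total weight is at least deg u. Both exceptions are bounded by Chebyshev's inequality.\<close>

lemma not_accept_prob_heavy:
  assumes q: "q > 0" and \<theta>: "\<theta> > 0" and large: "16 \<le> (real q)\<^sup>2 * (d / n)"
    and heavy: "real (card (edges G)) / 2 \<le> card {(v, u) \<in> up_arcs G. \<theta> \<le> real (deg G u)}"
  shows "1 - accept_prob q \<le> 64 * sqrt (n / d) / real q + 4 * n / (real q * \<theta>)"
proof -
  let ?V = "measure_pmf.expectation (rand_verts q)" and ?A = "measure_pmf.expectation (rand_arcs q)"
  note fin = finite_set_rand_verts finite_set_rand_arcs
  define g where "g x = real (weight x) * of_bool (\<theta> \<le> real (snd (snd x)))" for x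
  define \<mu> where "\<mu> = measure_pmf.expectation (arc_pmf G) g"
  have dn: "d > 0" "n > 0" using d_ge_1 n_pos by auto
  have "\<mu> = card {(v, u) \<in> up_arcs G. \<theta> \<le> real (deg G u)} / n"
    unfolding \<mu>_def g_def by (rule expectation_weight)
  moreover have "real (card (edges G)) / 2 / n \<le> card {(v, u) \<in> up_arcs G. \<theta> \<le> real (deg G u)} / n"
    using heavy by (intro divide_right_mono) auto
  moreover have "real (card (edges G)) / 2 / n = d / 4" by (simp add: avg_degree_def)
  ultimately have \<mu>: "d / 4 \<le> \<mu>" by linarith
  define B1 where "B1 = {E. (\<Sum>x\<leftarrow>E. g x) < real q * \<mu> / 2}"
  define C where "C u = {S. (\<Sum>s\<leftarrow>S. of_bool (adj G s u)) < real q * (deg G u / n) / 2}" for u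
  have "measure_pmf.prob (rand_arcs q) B1
      \<le> 4 * measure_pmf.expectation (arc_pmf G) (\<lambda>x. (g x)\<^sup>2) / (real q * \<mu>\<^sup>2)"
    unfolding B1_def \<mu>_def
    by (rule replicate_pmf_lower_tail[OF finite_set_arc_pmf _ q]) (use \<mu> dn in \<open>simp add: \<mu>_def\<close>)
  also have "\<dots> \<le> 4 * (sqrt (n * d) * d) / (real q * (d / 4)\<^sup>2)"
  proof (rule frac_le)
    have "measure_pmf.expectation (arc_pmf G) (\<lambda>x. (g x)\<^sup>2)
        \<le> measure_pmf.expectation (arc_pmf G) (\<lambda>x. (real (weight x))\<^sup>2)"
      by (intro pmf_expectation_mono_finite finite_set_arc_pmf) (auto simp: g_def)
    then show "4 * measure_pmf.expectation (arc_pmf G) (\<lambda>x. (g x)\<^sup>2) \<le> 4 * (sqrt (n * d) * d)"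
      using expectation_weight_square by simp
    show "real q * (d / 4)\<^sup>2 \<le> real q * \<mu>\<^sup>2"
      using \<mu> dn by (intro mult_left_mono power_mono) auto
  qed (use dn q in auto)
  also have "\<dots> = 64 * sqrt (n / d) / real q"
  proof -
    have "sqrt (n * d) = sqrt (n / d) * d"
      using dn by (simp add: real_sqrt_mult real_sqrt_divide field_simps)
    then show ?thesis using dn q by (simp add: power2_eq_square field_simps)
  qed
  finally have B1: "measure_pmf.prob (rand_arcs q) B1 \<le> 64 * sqrt (n / d) / real q" .
  have C: "measure_pmf.prob (rand_verts q) (C u) \<le> 4 * n / (real q * \<theta>)" if u: "\<theta> \<le> real (deg G u)" for u
  proof -
    have sq: "(of_bool (adj G s u) :: real)\<^sup>2 = of_bool (adj G s u)" for s by simp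
    have "measure_pmf.prob (rand_verts q) (C u) \<le> 4 * (deg G u / n) / (real q * (deg G u / n)\<^sup>2)"
      using replicate_pmf_lower_tail[OF finite_set_vertex _ q, of "\<lambda>s. of_bool (adj G s u)"] u \<theta> dn
      by (simp add: C_def expectation_adj sq)
    also have "\<dots> = 4 * n / (real q * deg G u)"
      using u \<theta> dn q by (simp add: power2_eq_square)
    also have "\<dots> \<le> 4 * n / (real q * \<theta>)"
      using u \<theta> dn q by (intro divide_left_mono mult_left_mono) auto
    finally show ?thesis .
  qed
  have le: "of_bool (\<not> accepts G S T E) \<le> indicat_real B1 E
      + of_bool (\<theta> \<le> real (deg G (fst (heaviest E)))) * indicat_real (C (fst (heaviest E))) S"
    if E: "E \<in> set_pmf (rand_arcs q)" for S T E
  proof (cases "E \<in> B1")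
    case False
    obtain u where u: "heaviest E = (u, deg G u)" "deg G u > 0" using set_rand_arcs_heaviest[OF E q] .
    have Eg: "real q * \<mu> / 2 \<le> (\<Sum>x\<leftarrow>E. g x)" using False by (simp add: B1_def)
    have "real q * (d / 4) / 2 \<le> real q * \<mu> / 2" using \<mu> by (intro divide_right_mono mult_left_mono) auto
    with Eg have Z1: "real q * d / 8 \<le> (\<Sum>x\<leftarrow>E. g x)" by linarith
    have "\<exists>x\<in>set E. \<theta> \<le> real (snd (snd x))"
    proof (rule ccontr)
      assume "\<not> ?thesis"
      then have "map g E = map (\<lambda>_. 0) E" by (intro map_cong) (auto simp: g_def)
      then have "(\<Sum>x\<leftarrow>E. g x) = 0" by (simp only: sum_list_0)
      moreover have "real q * d / 8 > 0" using q dn by simp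
      ultimately show False using Z1 by linarith
    qed
    then obtain x where x: "x \<in> set E" "\<theta> \<le> real (snd (snd x))" by blast
    have "E \<noteq> []" using x by auto
    then have D: "\<theta> \<le> real (deg G u)" using heaviest(2)[OF _ x(1)] x(2) u by simp
    show ?thesis
    proof (cases "S \<in> C u")
      case False
      then have cnt: "real q * (deg G u / n) / 2 \<le> (\<Sum>s\<leftarrow>S. of_bool (adj G s u))" by (simp add: C_def)
      have "(\<Sum>x\<leftarrow>E. g x) \<le> (\<Sum>x\<leftarrow>E. real (weight x))"
        by (intro sum_list_mono) (simp add: g_def)
      with Z1 have Z: "real q * d / 8 \<le> (\<Sum>x\<leftarrow>E. real (weight x))" by simp
      \<comment> \<open>The two lower bounds q deg u / (2 n) and q d / 8 multiply to deg u / 16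
        times q^2 d / n, and \<open>large\<close> pays for the 16.\<close>
      have "real (deg G u) * 16 \<le> real (deg G u) * ((real q)\<^sup>2 * (d / n))"
        using large by (intro mult_left_mono) auto
      then have "real (deg G u) \<le> real (deg G u) * ((real q)\<^sup>2 * (d / n)) / 16"
        by (simp only: pos_le_divide_eq zero_less_numeral)
      also have "\<dots> = (real q * (deg G u / n) / 2) * (real q * d / 8)"
        by (simp add: power2_eq_square mult_ac)
      also have "\<dots> \<le> (\<Sum>s\<leftarrow>S. of_bool (adj G s u)) * (\<Sum>x\<leftarrow>E. real (weight x))"
      proof (rule mult_mono[OF cnt Z])
        show "0 \<le> (\<Sum>s\<leftarrow>S. of_bool (adj G s u) :: real)" by (intro sum_list_nonneg) auto
      qed (use dn in simp)
      finally have "accepts G S T E" by (simp add: accepts_iff u)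
      then show ?thesis by simp
    qed (use D u in simp)
  qed simp
  define J where "J S E = of_bool (\<theta> \<le> real (deg G (fst (heaviest E)))) * indicat_real (C (fst (heaviest E))) S"
    for S E
  have "1 - accept_prob q \<le> ?V (\<lambda>S. ?V (\<lambda>T. ?A (\<lambda>E. indicat_real B1 E + J S E)))"
    unfolding not_accept_prob
    by (intro pmf_expectation_mono_finite finite_set_rand_verts finite_set_rand_arcs)
      (use le in \<open>simp only: J_def\<close>)
  also have "\<dots> = ?A (indicat_real B1) + ?V (\<lambda>S. ?A (J S))"
    by (simp only: pmf_expectation_add[OF finite_set_rand_verts] pmf_expectation_add[OF finite_set_rand_arcs]
      pmf_expectation_const)
  also have "?A (indicat_real B1) = measure_pmf.prob (rand_arcs q) B1" by simp
  \<comment> \<open>\<open>S\<close> is independent of \<open>E\<close>: for fixed \<open>E\<close>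
    the vertex u is fixed, and the bound on \<open>C u\<close> is uniform over all heavy u.\<close>
  also have "?V (\<lambda>S. ?A (J S)) = ?A (\<lambda>E. ?V (\<lambda>S. J S E))"
    by (rule pmf_expectation_swap[OF fin])
  also have "\<dots> \<le> ?A (\<lambda>E. 4 * n / (real q * \<theta>))"
  proof (rule pmf_expectation_mono_finite[OF finite_set_rand_arcs])
    fix E
    have "?V (\<lambda>S. J S E) = of_bool (\<theta> \<le> real (deg G (fst (heaviest E))))
        * measure_pmf.prob (rand_verts q) (C (fst (heaviest E)))" by (simp add: J_def)
    then show "?V (\<lambda>S. J S E) \<le> 4 * n / (real q * \<theta>)"
      using C[of "fst (heaviest E)"] dn q \<theta> by (cases "\<theta> \<le> real (deg G (fst (heaviest E)))") simp_all
  qed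
  finally show ?thesis using B1 by (simp only: pmf_expectation_const) linarith
qed

text \<open>Either at least half of the edges have a light upper end or at least half have a heavy
  one, so one of the two previous bounds applies.\<close>

lemma not_accept_prob_le:
  assumes q: "64000 * sqrt (n / d) \<le> real q"
  shows "1 - accept_prob q \<le> 0.0035"
proof -
  define r where "r = sqrt (n / d)"
  have dn: "d > 0" "n > 0" using d_ge_1 n_pos by auto
  have r: "r \<ge> 1" using sqrt_n_over_d_ge_1 by (simp add: r_def)
  have r2: "r\<^sup>2 = n / d" using dn by (simp add: r_def)
  have q0: "real q > 0" using q r unfolding r_def by linarith
  have big: "64000\<^sup>2 \<le> (real q)\<^sup>2 * (d / n)"
  proof -
    have "(64000 * r)\<^sup>2 \<le> (real q)\<^sup>2" using q r by (intro power_mono) (auto simp: r_def)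
    then have "64000\<^sup>2 * (n / d) \<le> (real q)\<^sup>2" by (simp add: power_mult_distrib r2)
    then show ?thesis using dn by (simp add: field_simps)
  qed
  \<comment> \<open>In the light case 2 q \<theta> / n is then only 4000, against q^2 d / n of at
    least 64000^2; in the heavy case 4 n / (q \<theta>) is 0.002, and the other term is at most
    0.001.\<close>
  define \<theta> where "\<theta> = 2000 * n / real q"
  have \<theta>: "\<theta> > 0" using dn q0 by (simp add: \<theta>_def)
  have "card (up_arcs G)
      = card ({(v, u) \<in> up_arcs G. real (deg G u) < \<theta>} \<union> {(v, u) \<in> up_arcs G. \<theta> \<le> real (deg G u)})"
    by (rule arg_cong[where f = card]) auto
  also have "\<dots> \<le> card {(v, u) \<in> up_arcs G. real (deg G u) < \<theta>}
      + card {(v, u) \<in> up_arcs G. \<theta> \<le> real (deg G u)}"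
    by (rule card_Un_le)
  finally have "real (card (edges G)) \<le> real (card {(v, u) \<in> up_arcs G. real (deg G u) < \<theta>})
      + real (card {(v, u) \<in> up_arcs G. \<theta> \<le> real (deg G u)})"
    unfolding card_up_arcs of_nat_add[symmetric] of_nat_le_iff .
  then consider
      "real (card (edges G)) / 2 \<le> card {(v, u) \<in> up_arcs G. real (deg G u) < \<theta>}"
    | "real (card (edges G)) / 2 \<le> card {(v, u) \<in> up_arcs G. \<theta> \<le> real (deg G u)}"
    by linarith
  then show ?thesis
  proof cases
    case 1
    have "1 - accept_prob q \<le> 4 * (1 + 2 * real q * (\<theta> / n)) / ((real q)\<^sup>2 * (d / n))"
      using q0 \<theta> 1 by (intro not_accept_prob_light) auto
    also have "1 + 2 * real q * (\<theta> / n) = 4001" using q0 dn by (simp add: \<theta>_def)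
    also have "4 * 4001 / ((real q)\<^sup>2 * (d / n)) \<le> 4 * 4001 / 64000\<^sup>2"
      by (rule divide_left_mono[OF big]) (use q0 dn in simp_all)
    also have "\<dots> \<le> 0.0035" by simp
    finally show ?thesis by simp
  next
    case 2
    have "1 - accept_prob q \<le> 64 * r / real q + 4 * n / (real q * \<theta>)"
      unfolding r_def using q0 \<theta> 2 big by (intro not_accept_prob_heavy) auto
    also have "4 * n / (real q * \<theta>) = 0.002" using q0 dn by (simp add: \<theta>_def)
    also have "64 * r / real q \<le> 0.001" using q q0 by (simp add: r_def divide_le_eq)
    finally show ?thesis by simp
  qed
qed

end

section \<open>The algorithm\<close>

lemma run_Output: "run M G K (Output x) = return_spmf (x, 0)"
  by (subst run.simps) simp

lemma run_Query: "run M G K (Query q f) = bind_pmf (respond M G K q)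
    (\<lambda>a. map_spmf (\<lambda>(r, t). (r, query_cost q + t)) (run M G (K \<union> revealed a) (f a)))"
  by (subst run.simps) simp

lemma run_Choose: "run M G K (Choose D) = bind_pmf D (run M G K)"
  by (subst run.simps) simp

text \<open>
  The outcome \<open>Inr s\<close> of a program asks to continue with \<open>B s\<close>; the trivial \<open>Choose\<close> guards this
  corecursive call.
\<close>

primcorec iterate :: "('s \<Rightarrow> ('a + 's) program) \<Rightarrow> ('a + 's) program \<Rightarrow> 'a program" where
  "iterate B p = (case p of
      Output x \<Rightarrow> (case x of Inl r \<Rightarrow> Output r | Inr s \<Rightarrow> Choose (map_pmf (iterate B) (return_pmf (B s))))
    | Query q f \<Rightarrow> Query q (\<lambda>a. iterate B (f a))
    | Choose D \<Rightarrow> Choose (map_pmf (iterate B) D))"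

section \<open>Program combinators for sampling\<close>

text \<open>The default 0 is never met: the estimator asks only offered queries about revealed
  identifiers, and these return answers of the right kind.\<close>

fun vertex_of :: "answer \<Rightarrow> nat" where
  "vertex_of (Vertex x) = x"
| "vertex_of _ = 0"

fun number_of :: "answer \<Rightarrow> nat" where
  "number_of (Number k) = k"
| "number_of _ = 0"

definition draw_vertex :: "(nat \<Rightarrow> 'a program) \<Rightarrow> 'a program" where
  "draw_vertex k = Query RandVert (\<lambda>a. k (vertex_of a))"

definition draw_arc :: "((nat \<times> nat) \<times> (nat \<times> nat) \<Rightarrow> 'a program) \<Rightarrow> 'a program" where
  "draw_arc k = Query RandVert (\<lambda>v. Query (RandNbr (vertex_of v)) (\<lambda>u.
     Query (Degree (vertex_of v)) (\<lambda>a. Query (Degree (vertex_of u)) (\<lambda>b.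
       k ((vertex_of v, number_of a), (vertex_of u, number_of b))))))"

primrec repeat_prog ::
  "nat \<Rightarrow> (('b \<Rightarrow> 'a program) \<Rightarrow> 'a program) \<Rightarrow> ('b list \<Rightarrow> 'a program) \<Rightarrow> 'a program" where
  "repeat_prog 0 c k = k []"
| "repeat_prog (Suc N) c k = c (\<lambda>x. repeat_prog N c (\<lambda>xs. k (x # xs)))"

primrec count_adjacent :: "nat \<Rightarrow> nat list \<Rightarrow> (nat \<Rightarrow> 'a program) \<Rightarrow> 'a program" where
  "count_adjacent u [] k = k 0"
| "count_adjacent u (s # S) k =
     Query (Additive {u, s}) (\<lambda>a. count_adjacent u S (\<lambda>c. k (number_of a + c)))"

section \<open>Calculus of success probabilities\<close>

text \<open>Here \<open>p\<close> is the rest of the current round, \<open>K\<close> the identifiers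
  known by then and \<open>T\<close> the remaining cost budget; lower bounds on this quantity are
  propagated backwards through the program.\<close>

definition success ::
  "graph \<Rightarrow> ('s \<Rightarrow> ('a + 's) program) \<Rightarrow> ('a \<Rightarrow> bool) \<Rightarrow> nat set \<Rightarrow> ('a + 's) program \<Rightarrow> nat \<Rightarrow> real" where
  "success G B Q K p T = measure (measure_spmf (run Advanced G K (iterate B p))) {(r, t). Q r \<and> t \<le> T}"

text \<open>
  The program combinators are in continuation-passing style: \<open>c k\<close> acts like drawing \<open>x\<close> from \<open>p\<close> and
  continuing with \<open>k x\<close>, at cost at most \<open>C\<close> and with the identifiers \<open>ids x\<close> being known afterwards.
\<close>

definition implements ::
  "graph \<Rightarrow> (('b \<Rightarrow> ('a + 's) program) \<Rightarrow> ('a + 's) program) \<Rightarrow> 'b pmf \<Rightarrow> nat \<Rightarrow> ('b \<Rightarrow> nat set) \<Rightarrow> bool" where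
  "implements G c p C ids \<longleftrightarrow> (\<forall>B Q K k T g.
     (\<forall>x\<in>set_pmf p. \<forall>K'. K \<union> ids x \<subseteq> K' \<longrightarrow> g x \<le> success G B Q K' (k x) T) \<longrightarrow>
     measure_pmf.expectation p g \<le> success G B Q K (c k) (C + T))"

lemma measure_spmf_bind_pmf_expectation:
  "measure (measure_spmf (bind_pmf p f)) A = measure_pmf.expectation p (\<lambda>x. measure (measure_spmf (f x)) A)"
proof -
  have "ennreal (measure (measure_spmf (bind_pmf p f)) A) = emeasure (measure_spmf (bind_pmf p f)) A"
    by (simp add: measure_spmf.emeasure_eq_measure)
  also have "\<dots> = (\<integral>\<^sup>+x. emeasure (measure_spmf (f x)) A \<partial>p)"
    by (simp add: emeasure_measure_spmf_conv_measure_pmf)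
  also have "\<dots> = (\<integral>\<^sup>+x. ennreal (measure (measure_spmf (f x)) A) \<partial>p)"
    by (simp add: measure_spmf.emeasure_eq_measure)
  also have "\<dots> = ennreal (measure_pmf.expectation p (\<lambda>x. measure (measure_spmf (f x)) A))"
    by (intro nn_integral_eq_integral measure_pmf.integrable_const_bound[where B = 1])
       (auto simp: measure_spmf.subprob_measure_le_1)
  finally show ?thesis by (simp add: integral_nonneg_AE)
qed

lemma success_nonneg: "0 \<le> success G B Q K p T"
  by (simp add: success_def)

lemma success_mono: "T \<le> T' \<Longrightarrow> success G B Q K p T \<le> success G B Q K p T'"
  unfolding success_def by (intro measure_spmf.finite_measure_mono) auto

lemma success_Output_Inl: "Q r \<Longrightarrow> success G B Q K (Output (Inl r)) T = 1"
  by (simp add: success_def iterate.code run_Output measure_spmf_return_spmf measure_return)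

text \<open>The \<open>Choose\<close> that guards the corecursive call asks no query, so the next
  round starts with the same budget and the same known identifiers.\<close>

lemma success_Output_Inr: "success G B Q K (Output (Inr s)) T = success G B Q K (B s) T"
proof -
  have "iterate B (Output (Inr s)) = Choose (return_pmf (iterate B (B s)))"
    by (subst iterate.code) simp
  then show ?thesis by (simp add: success_def run_Choose bind_return_pmf)
qed

lemma success_Query:
  assumes "offers Advanced q" "mentioned q \<subseteq> K"
  shows "success G B Q K (Query q f) (query_cost q + T)
    = measure_pmf.expectation (true_answer G q) (\<lambda>a. success G B Q (K \<union> revealed a) (f a) T)"
proof -
  have it: "iterate B (Query q f) = Query q (\<lambda>a. iterate B (f a))" by (subst iterate.code) simp
  have vi: "(\<lambda>(r, t). (r, query_cost q + t)) -` {(r, t). Q r \<and> t \<le> query_cost q + T} = {(r, t). Q r \<and> t \<le> T}"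
    by auto
  have "respond Advanced G K q = true_answer G q" using assms by (simp add: respond_def)
  then show ?thesis
    by (simp only: success_def it run_Query measure_spmf_bind_pmf_expectation measure_map_spmf vi)
qed

lemma success_Additive:
  assumes "S \<subseteq> K"
  shows "success G B Q K (f (Number (card {e \<in> edges G. e \<subseteq> S}))) T
    \<le> success G B Q K (Query (Additive S) f) (card S + T)"
  using success_Query[of "Additive S" K G B Q f T] assms by simp

text \<open>A query costs 2, or 1 if \<open>s\<close> is \<open>u\<close> itself, so the cost is
  only bounded from above.\<close>

lemma success_count_adjacent:
  assumes "u \<in> K" "set S \<subseteq> K"
  shows "success G B Q K (k (\<Sum>s\<leftarrow>S. card {e \<in> edges G. e \<subseteq> {u, s}})) T
    \<le> success G B Q K (count_adjacent u S k) (2 * length S + T)"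
  using assms(2)
proof (induction S arbitrary: k)
  case (Cons s S)
  let ?a = "\<lambda>s. card {e \<in> edges G. e \<subseteq> {u, s}}"
  have "success G B Q K (k (\<Sum>s\<leftarrow>s # S. ?a s)) T
      \<le> success G B Q K (count_adjacent u S (\<lambda>c. k (?a s + c))) (2 * length S + T)"
    using Cons by simp
  also have "\<dots> \<le> success G B Q K (count_adjacent u (s # S) k) (card {u, s} + (2 * length S + T))"
    using success_Additive[of "{u, s}" K G B Q "\<lambda>a. count_adjacent u S (\<lambda>c. k (number_of a + c))"] Cons.prems assms(1)
    by simp
  also have "\<dots> \<le> success G B Q K (count_adjacent u (s # S) k) (2 * length (s # S) + T)"
    by (rule success_mono) (simp add: card_insert_if)
  finally show ?case .
qed simp

lemma implementsD:
  assumes "implements G c p C ids"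
    and "\<And>x K'. x \<in> set_pmf p \<Longrightarrow> K \<union> ids x \<subseteq> K' \<Longrightarrow> g x \<le> success G B Q K' (k x) T"
  shows "measure_pmf.expectation p g \<le> success G B Q K (c k) (C + T)"
  by (rule assms(1)[unfolded implements_def, rule_format]) (rule assms(2))

text \<open>Since \<open>implements\<close> covers every set of known identifiers, the induction can
  continue from the set enlarged by the first sample.\<close>

lemma implements_repeat_prog:
  fixes c :: "('b \<Rightarrow> ('a + 's) program) \<Rightarrow> ('a + 's) program"
  assumes c: "implements G c p C ids" and fin: "finite (set_pmf p)"
  shows "implements G (repeat_prog N c) (replicate_pmf N p) (N * C) (\<lambda>xs. \<Union>x\<in>set xs. ids x)"
proof (induction N)
  case 0
  show ?case by (auto simp: implements_def)
next
  case (Suc N)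
  show ?case
    unfolding implements_def
  proof (intro allI impI)
    fix B :: "'s \<Rightarrow> ('a + 's) program" and Q K and k :: "'b list \<Rightarrow> ('a + 's) program"
      and T and g :: "'b list \<Rightarrow> real"
    assume g: "\<forall>xs\<in>set_pmf (replicate_pmf (Suc N) p). \<forall>K'. K \<union> (\<Union>x\<in>set xs. ids x) \<subseteq> K' \<longrightarrow>
      g xs \<le> success G B Q K' (k xs) T"
    have "measure_pmf.expectation p (\<lambda>x. measure_pmf.expectation (replicate_pmf N p) (\<lambda>xs. g (x # xs)))
        \<le> success G B Q K (c (\<lambda>x. repeat_prog N c (\<lambda>xs. k (x # xs)))) (C + (N * C + T))"
    proof (rule implementsD[OF c])
      fix x K' assume x: "x \<in> set_pmf p" "K \<union> ids x \<subseteq> K'"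
      show "measure_pmf.expectation (replicate_pmf N p) (\<lambda>xs. g (x # xs))
          \<le> success G B Q K' (repeat_prog N c (\<lambda>xs. k (x # xs))) (N * C + T)"
      proof (rule implementsD[OF Suc])
        fix xs K'' assume xs: "xs \<in> set_pmf (replicate_pmf N p)" "K' \<union> (\<Union>x\<in>set xs. ids x) \<subseteq> K''"
        have "x # xs \<in> set_pmf (replicate_pmf (Suc N) p)" using x xs by auto
        moreover have "K \<union> (\<Union>y\<in>set (x # xs). ids y) \<subseteq> K''" using x(2) xs(2) by auto
        ultimately show "g (x # xs) \<le> success G B Q K'' (k (x # xs)) T"
          by (rule g[rule_format])
      qed
    qed
    moreover have "C + (N * C + T) = Suc N * C + T" by simp
    ultimately show "measure_pmf.expectation (replicate_pmf (Suc N) p) g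
        \<le> success G B Q K (repeat_prog (Suc N) c k) (Suc N * C + T)"
      by (simp only: expectation_replicate_pmf_Suc[OF fin] repeat_prog.simps)
  qed
qed

context query_input
begin

lemma implements_draw_vertex:
  "implements G (draw_vertex :: (nat \<Rightarrow> ('a + 's) program) \<Rightarrow> _) rand_vert 1 (\<lambda>x. {x})"
  unfolding implements_def
proof (intro allI impI)
  fix B :: "'s \<Rightarrow> ('a + 's) program" and Q K and k :: "nat \<Rightarrow> ('a + 's) program"
    and T and g :: "nat \<Rightarrow> real"
  assume g: "\<forall>x\<in>set_pmf rand_vert. \<forall>K'. K \<union> {x} \<subseteq> K' \<longrightarrow> g x \<le> success G B Q K' (k x) T"
  have "measure_pmf.expectation rand_vert g
      \<le> measure_pmf.expectation rand_vert (\<lambda>x. success G B Q (K \<union> {x}) (k x) T)"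
    using g by (intro pmf_expectation_mono_finite finite_set_vertex) blast
  also have "\<dots> = success G B Q K (draw_vertex k) (1 + T)"
    using success_Query[of RandVert K G B Q "\<lambda>a. k (vertex_of a)" T] by (simp add: draw_vertex_def)
  finally show "measure_pmf.expectation rand_vert g \<le> success G B Q K (draw_vertex k) (1 + T)" .
qed

text \<open>Four queries of cost 1; each endpoint has been revealed before a query mentions it, so
  nothing is refused.\<close>

lemma implements_draw_arc:
  "implements G (draw_arc :: (_ \<Rightarrow> ('a + 's) program) \<Rightarrow> _) (arc_pmf G) 4 (\<lambda>x. {fst (fst x), fst (snd x)})"
  unfolding implements_def
proof (intro allI impI)
  fix B :: "'s \<Rightarrow> ('a + 's) program" and Q K
    and k :: "(nat \<times> nat) \<times> (nat \<times> nat) \<Rightarrow> ('a + 's) program"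
    and T and g :: "(nat \<times> nat) \<times> (nat \<times> nat) \<Rightarrow> real"
  assume g: "\<forall>x\<in>set_pmf (arc_pmf G). \<forall>K'. K \<union> {fst (fst x), fst (snd x)} \<subseteq> K' \<longrightarrow>
    g x \<le> success G B Q K' (k x) T"
  define p4 where "p4 v u a = Query (Degree u) (\<lambda>b. k ((v, a), (u, number_of b)))" for v u a
  define p3 where "p3 v u = Query (Degree v) (\<lambda>a. p4 v u (number_of a))" for v u
  define p2 where "p2 v = Query (RandNbr v) (\<lambda>u. p3 v (vertex_of u))" for v
  have p1: "draw_arc k = Query RandVert (\<lambda>v. p2 (vertex_of v))"
    by (simp add: draw_arc_def p2_def p3_def p4_def)
  have finN: "finite (set_pmf (pmf_of_set (nbrs G v)))" "set_pmf (pmf_of_set (nbrs G v)) = nbrs G v"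
    if "v \<in> verts G" for v
    using nbrs_nonempty[OF that] finite_nbrs[OF simple] by (simp_all add: set_pmf_of_set)
  have setV: "set_pmf rand_vert = verts G" using finite_verts verts_nonempty by (simp add: set_pmf_of_set)
  have s3: "success G B Q (K \<union> {v} \<union> {u}) (p3 v u) (Suc (Suc T)) = success G B Q (K \<union> {v} \<union> {u}) (k (label G v, label G u)) T" for v u
    using success_Query[of "Degree v" "K \<union> {v} \<union> {u}" G B Q _ "Suc T"]
      success_Query[of "Degree u" "K \<union> {v} \<union> {u}" G B Q _ T]
    by (simp add: p3_def p4_def label_def)
  have s2: "success G B Q (K \<union> {v}) (p2 v) (Suc (Suc (Suc T)))
      = measure_pmf.expectation (pmf_of_set (nbrs G v)) (\<lambda>u. success G B Q (K \<union> {v} \<union> {u}) (k (label G v, label G u)) T)" for v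
    using success_Query[of "RandNbr v" "K \<union> {v}" G B Q _ "Suc (Suc T)"] s3[of v]
    by (simp add: p2_def insert_commute)
  have s1: "success G B Q K (draw_arc k) (4 + T) = measure_pmf.expectation rand_vert (\<lambda>v.
      measure_pmf.expectation (pmf_of_set (nbrs G v)) (\<lambda>u. success G B Q (K \<union> {v} \<union> {u}) (k (label G v, label G u)) T))"
    using success_Query[of RandVert K G B Q _ "Suc (Suc (Suc T))"] s2
    by (simp add: p1 numeral_eq_Suc)
  have "measure_pmf.expectation (arc_pmf G) g = measure_pmf.expectation rand_vert (\<lambda>v.
      measure_pmf.expectation (pmf_of_set (nbrs G v)) (\<lambda>u. g (label G v, label G u)))"
    unfolding arc_pmf_def using finN setV finite_verts by (subst pmf_expectation_bind_finite) auto
  also have "\<dots> \<le> success G B Q K (draw_arc k) (4 + T)"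
    unfolding s1
  proof (rule pmf_expectation_mono_finite[OF finite_set_vertex])
    fix v assume "v \<in> set_pmf rand_vert"
    then have v: "v \<in> verts G" by (simp add: setV)
    show "measure_pmf.expectation (pmf_of_set (nbrs G v)) (\<lambda>u. g (label G v, label G u))
        \<le> measure_pmf.expectation (pmf_of_set (nbrs G v)) (\<lambda>u. success G B Q (K \<union> {v} \<union> {u}) (k (label G v, label G u)) T)"
    proof (rule pmf_expectation_mono_finite[OF finN(1)[OF v]])
      fix u assume "u \<in> set_pmf (pmf_of_set (nbrs G v))"
      then have "(label G v, label G u) \<in> set_pmf (arc_pmf G)"
        using v finN(2)[OF v] by (auto simp: arc_pmf_def setV)
      then show "g (label G v, label G u) \<le> success G B Q (K \<union> {v} \<union> {u}) (k (label G v, label G u)) T"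
        using g[rule_format, of "(label G v, label G u)" "K \<union> {v} \<union> {u}"] by (auto simp: label_def)
    qed
  qed
  finally show "measure_pmf.expectation (arc_pmf G) g \<le> success G B Q K (draw_arc k) (4 + T)" .
qed

lemmas implements_rand_verts = implements_repeat_prog[OF implements_draw_vertex finite_set_vertex]
lemmas implements_rand_arcs = implements_repeat_prog[OF implements_draw_arc finite_set_arc_pmf]

end

section \<open>The estimator\<close>

text \<open>The factor 2 is due to the mean d / 2 of \<open>weight\<close>; \<open>Inl\<close> ends
  the loop.\<close>

definition final_phase :: "nat \<Rightarrow> (real + nat) program" where
  "final_phase N = repeat_prog N draw_arc
     (\<lambda>E. Output (Inl (2 * (\<Sum>x\<leftarrow>E. real (weight x)) / real N)))"

text \<open>Sample size of the final phase per unit of 2^i. The constant makes its failure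
  probability after acceptance in round i at most 4 sqrt (n / d) / (2^i 10^9).\<close>

definition repetitions :: "real \<Rightarrow> nat" where
  "repetitions \<epsilon> = nat \<lceil>10 ^ 9 / \<epsilon>\<^sup>2\<rceil>"

text \<open>\<open>S\<close> serves both statistics: together with \<open>T\<close> it spans the
  edges counted first, and alone it is tested for adjacency to \<open>heaviest E\<close>, of which
  it is independent.\<close>

definition doubling_round :: "real \<Rightarrow> nat \<Rightarrow> (real + nat) program" where
  "doubling_round \<epsilon> i =
     repeat_prog (2 ^ i) draw_vertex (\<lambda>S.
     repeat_prog (2 ^ i) draw_vertex (\<lambda>T.
     Query (Additive (set S \<union> set T)) (\<lambda>a.
     repeat_prog (2 ^ i) draw_arc (\<lambda>E.
     count_adjacent (fst (heaviest E)) S (\<lambda>c.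
       if accept_test (number_of a) c E then final_phase (repetitions \<epsilon> * 2 ^ i)
       else Output (Inr (Suc i)))))))"

definition estimator :: "real \<Rightarrow> real program" where
  "estimator \<epsilon> = iterate (doubling_round \<epsilon>) (doubling_round \<epsilon> 0)"

context query_input
begin

section \<open>Analysis of the estimator\<close>

text \<open>Chebyshev's inequality for a deviation N \<epsilon> d / 2 of the total weight, where the
  N second moments add up to at most N sqrt (n / d) d^2.\<close>

lemma success_final_phase:
  assumes \<epsilon>: "0 < \<epsilon>" and N: "N > 0"
  shows "1 - 4 * sqrt (n / d) / (real N * \<epsilon>\<^sup>2) \<le> success G B (eps_approx \<epsilon> G) K (final_phase N) (N * 4 + T)"
proof -
  let ?W = "\<lambda>E. \<Sum>x\<leftarrow>E. real (weight x)"
  have dn: "d > 0" "n > 0" using d_ge_1 n_pos by auto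
  define bad where "bad = {E. \<not> eps_approx \<epsilon> G (2 * ?W E / real N)}"
  define a where "a = real N * \<epsilon> * d / 2"
  have a: "a > 0" using \<epsilon> N dn by (simp add: a_def)
  have "measure_pmf.prob (rand_arcs N) bad
      \<le> real N * measure_pmf.expectation (arc_pmf G) (\<lambda>x. (real (weight x))\<^sup>2) / a\<^sup>2"
  proof (rule replicate_pmf_Chebyshev[OF finite_set_arc_pmf a])
    fix E assume "E \<in> bad"
    then have "\<epsilon> * d < \<bar>2 * ?W E / real N - d\<bar>"
      by (auto simp: bad_def eps_approx_def algebra_simps)
    also have "\<dots> = \<bar>?W E - real N * (d / 2)\<bar> * (2 / real N)"
      using N by (simp add: abs_mult[symmetric] abs_divide[symmetric] field_simps)
    finally show "a \<le> \<bar>?W E - real N * measure_pmf.expectation (arc_pmf G) (\<lambda>x. real (weight x))\<bar>"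
      unfolding expectation_weight_total a_def using N by (simp add: field_simps)
  qed
  also have "\<dots> \<le> real N * (sqrt (n * d) * d) / a\<^sup>2"
    using expectation_weight_square by (intro divide_right_mono mult_left_mono) auto
  also have "\<dots> = 4 * sqrt (n / d) / (real N * \<epsilon>\<^sup>2)"
  proof -
    have "sqrt (n * d) = sqrt (n / d) * d"
      using dn by (simp add: real_sqrt_mult real_sqrt_divide field_simps)
    then show ?thesis using dn N \<epsilon> by (simp add: power2_eq_square a_def field_simps)
  qed
  finally have bad: "measure_pmf.prob (rand_arcs N) bad \<le> 4 * sqrt (n / d) / (real N * \<epsilon>\<^sup>2)" .
  have "1 - measure_pmf.prob (rand_arcs N) bad = measure_pmf.prob (rand_arcs N) (- bad)"
    using measure_pmf.prob_compl[of bad "rand_arcs N"] by (simp add: Compl_eq_Diff_UNIV)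
  also have "\<dots> = measure_pmf.expectation (rand_arcs N) (indicat_real (- bad))" by simp
  also have "\<dots> \<le> success G B (eps_approx \<epsilon> G) K (final_phase N) (N * 4 + T)"
    unfolding final_phase_def
  proof (rule implementsD[OF implements_rand_arcs])
    fix E K'
    show "indicat_real (- bad) E
        \<le> success G B (eps_approx \<epsilon> G) K' (Output (Inl (2 * ?W E / real N))) T"
      by (cases "E \<in> bad") (auto simp: bad_def success_nonneg success_Output_Inl)
  qed
  finally show ?thesis using bad by linarith
qed

lemma accept_prob_bounds: "0 \<le> accept_prob q" "accept_prob q \<le> 1"
proof -
  have "0 \<le> 1 - accept_prob q" unfolding not_accept_prob by simp
  then show "accept_prob q \<le> 1" by simp
qed (simp add: accept_prob_def)

text \<open>A round leads to the final phase, worth at least \<beta>, or to the next round, worth at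
  least \<open>w\<close>. For q = 2^i, its own cost is at most q + q + 2q + 4q + 2q for
  \<open>S\<close>, \<open>T\<close>, the edge count, the arcs and the adjacency count.\<close>

lemma success_doubling_round:
  assumes \<beta>: "\<And>K. \<beta> \<le> success G B Q K (final_phase (repetitions \<epsilon> * 2 ^ i)) T"
    and w: "\<And>K. w \<le> success G B Q K (Output (Inr (Suc i))) T"
  shows "accept_prob (2 ^ i) * \<beta> + (1 - accept_prob (2 ^ i)) * w
    \<le> success G B Q K (doubling_round \<epsilon> i) (10 * 2 ^ i + T)"
proof -
  let ?q = "2 ^ i :: nat"
  \<comment> \<open>Affine in the acceptance indicator, so that linearity yields the mixture of
    \<beta> and \<open>w\<close>.\<close>
  define g where "g S T E = w + (\<beta> - w) * of_bool (accepts G S T E)" for S T E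
  have q: "?q > 0" by simp
  have arcs: "measure_pmf.expectation (rand_arcs ?q) (g S T') \<le> success G B Q K
      (repeat_prog ?q draw_arc (\<lambda>E. count_adjacent (fst (heaviest E)) S (\<lambda>c.
        if accept_test (card {e \<in> edges G. e \<subseteq> set S \<union> set T'}) c E
        then final_phase (repetitions \<epsilon> * 2 ^ i) else Output (Inr (Suc i)))))
      (?q * 4 + (2 * length S + T))" if S: "set S \<subseteq> K" for S T' K
  proof (rule implementsD[OF implements_rand_arcs])
    fix E K'
    assume E: "E \<in> set_pmf (rand_arcs ?q)" and K': "K \<union> (\<Union>x\<in>set E. {fst (fst x), fst (snd x)}) \<subseteq> K'"
    have "E \<noteq> []" using E by (auto simp: set_replicate_pmf)
    then have u: "fst (heaviest E) \<in> K'" using heaviest(1)[of E] K' by auto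
    have S': "set S \<subseteq> K'" using S K' by blast
    let ?k = "\<lambda>c. if accept_test (card {e \<in> edges G. e \<subseteq> set S \<union> set T'}) c E
        then final_phase (repetitions \<epsilon> * 2 ^ i) else Output (Inr (Suc i))"
    have "g S T' E \<le> success G B Q K' (?k (\<Sum>s\<leftarrow>S. card {e \<in> edges G. e \<subseteq> {fst (heaviest E), s}})) T"
      unfolding g_def accepts_def using \<beta> w by (simp split: if_split)
    also have "\<dots> \<le> success G B Q K' (count_adjacent (fst (heaviest E)) S ?k) (2 * length S + T)"
      by (rule success_count_adjacent[OF u S'])
    finally show "g S T' E \<le> success G B Q K' (count_adjacent (fst (heaviest E)) S ?k) (2 * length S + T)" .
  qed
  have "measure_pmf.expectation (rand_verts ?q) (\<lambda>S. measure_pmf.expectation (rand_verts ?q) (\<lambda>T'.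
      measure_pmf.expectation (rand_arcs ?q) (g S T')))
    \<le> success G B Q K (doubling_round \<epsilon> i) (?q * 1 + (?q * 1 + (2 * ?q + (?q * 4 + (2 * ?q + T)))))"
    unfolding doubling_round_def
  proof (rule implementsD[OF implements_rand_verts], rule implementsD[OF implements_rand_verts])
    fix S K1 T' K2
    assume S: "S \<in> set_pmf (rand_verts ?q)" and K1: "K \<union> (\<Union>x\<in>set S. {x}) \<subseteq> K1"
      and T': "T' \<in> set_pmf (rand_verts ?q)" and K2: "K1 \<union> (\<Union>x\<in>set T'. {x}) \<subseteq> K2"
    let ?k = "\<lambda>a. repeat_prog ?q draw_arc (\<lambda>E. count_adjacent (fst (heaviest E)) S (\<lambda>c.
        if accept_test (number_of a) c E
        then final_phase (repetitions \<epsilon> * 2 ^ i) else Output (Inr (Suc i))))"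
    have len: "length S = ?q" "length T' = ?q" using S T' by (auto simp: set_replicate_pmf)
    have sub: "set S \<union> set T' \<subseteq> K2" using K1 K2 by auto
    have "card (set S \<union> set T') \<le> 2 * ?q"
      using card_Un_le[of "set S" "set T'"] card_length[of S] card_length[of T'] len by linarith
    then have card: "card (set S \<union> set T') + (?q * 4 + (2 * ?q + T)) \<le> 2 * ?q + (?q * 4 + (2 * ?q + T))"
      by simp
    have "measure_pmf.expectation (rand_arcs ?q) (g S T')
        \<le> success G B Q K2 (?k (Number (card {e \<in> edges G. e \<subseteq> set S \<union> set T'}))) (?q * 4 + (2 * ?q + T))"
      using arcs[of S K2 T'] sub len by simp
    also have "\<dots> \<le> success G B Q K2 (Query (Additive (set S \<union> set T')) ?k)
        (card (set S \<union> set T') + (?q * 4 + (2 * ?q + T)))"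
      by (rule success_Additive[OF sub])
    also have "\<dots> \<le> success G B Q K2 (Query (Additive (set S \<union> set T')) ?k)
        (2 * ?q + (?q * 4 + (2 * ?q + T)))"
      by (rule success_mono[OF card])
    finally show "measure_pmf.expectation (rand_arcs ?q) (g S T')
        \<le> success G B Q K2 (Query (Additive (set S \<union> set T')) ?k) (2 * ?q + (?q * 4 + (2 * ?q + T)))" .
  qed
  also have "?q * 1 + (?q * 1 + (2 * ?q + (?q * 4 + (2 * ?q + T)))) = 10 * 2 ^ i + T" by simp
  also have "measure_pmf.expectation (rand_verts ?q) (\<lambda>S. measure_pmf.expectation (rand_verts ?q) (\<lambda>T'.
      measure_pmf.expectation (rand_arcs ?q) (g S T'))) = w + (\<beta> - w) * accept_prob ?q"
    unfolding g_def accept_prob_def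
    by (simp only: pmf_expectation_add[OF finite_set_rand_verts] pmf_expectation_add[OF finite_set_rand_arcs]
      pmf_expectation_const integral_mult_right_zero)
  finally show ?thesis by (simp add: algebra_simps)
qed

lemma repetitions_ge: "10 ^ 9 / \<epsilon>\<^sup>2 \<le> real (repetitions \<epsilon>)"
  unfolding repetitions_def by linarith

text \<open>Accepting too early has probability proportional to \<open>4\<^sup>i\<close> and the final average then
  fails with probability proportional to \<open>2\<^sup>-\<^sup>i\<close>, so that the products form a geometric series
  dominated by its last term.\<close>

lemma success_doubling_rounds:
  assumes \<epsilon>: "0 < \<epsilon>" and I: "64000 * sqrt (n / d) \<le> 2 ^ I" and i: "i \<le> I"
  shows "1 - (0.0035 + (2 * 2 ^ I - 2 ^ i) * (1 / 10 ^ 8 / sqrt (n / d)))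
    \<le> success G (doubling_round \<epsilon>) (eps_approx \<epsilon> G) K (doubling_round \<epsilon> i)
        (10 * (2 * 2 ^ I - 2 ^ i) + repetitions \<epsilon> * 2 ^ I * 4)"
  using i
proof (induction i arbitrary: K rule: inc_induct)
  let ?S = "success G (doubling_round \<epsilon>) (eps_approx \<epsilon> G)"
  let ?F = "repetitions \<epsilon> * 2 ^ I * 4"
  define r where "r = sqrt (n / d)"
  have dn: "d > 0" "n > 0" using d_ge_1 n_pos by auto
  have r: "r \<ge> 1" "r\<^sup>2 = n / d" using sqrt_n_over_d_ge_1 dn by (auto simp: r_def)
  \<comment> \<open>Accepting in round i and then failing will have probability at most 2^i z;
    summed over the rounds i to I this is (2 * 2^I - 2^i) z.\<close>
  define z where "z = 1 / 10 ^ 8 / r"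
  have z: "z > 0" using r by (simp add: z_def)
  define \<beta> where "\<beta> i = 1 - 4 * r / (real (repetitions \<epsilon> * 2 ^ i) * \<epsilon>\<^sup>2)" for i
  have R: "10 ^ 9 \<le> real (repetitions \<epsilon>) * \<epsilon>\<^sup>2"
    using repetitions_ge[of \<epsilon>] \<epsilon> by (simp add: divide_le_eq)
  have R0: "repetitions \<epsilon> > 0"
  proof (rule ccontr)
    assume "\<not> repetitions \<epsilon> > 0"
    then show False using R by simp
  qed
  have \<beta>: "\<beta> i \<le> ?S K (final_phase (repetitions \<epsilon> * 2 ^ i)) T"
    if "i \<le> I" "?F \<le> T" for i K T
  proof -
    have "\<beta> i \<le> ?S K (final_phase (repetitions \<epsilon> * 2 ^ i)) (repetitions \<epsilon> * 2 ^ i * 4 + 0)"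
      unfolding \<beta>_def r_def using \<epsilon> R0 by (intro success_final_phase) auto
    also have "\<dots> \<le> ?S K (final_phase (repetitions \<epsilon> * 2 ^ i)) T"
    proof (rule success_mono)
      have "(2::nat) ^ i \<le> 2 ^ I" using that by (intro power_increasing) auto
      then have "repetitions \<epsilon> * 2 ^ i \<le> repetitions \<epsilon> * 2 ^ I" by (rule mult_le_mono2)
      then show "repetitions \<epsilon> * 2 ^ i * 4 + 0 \<le> T" using that(2) by linarith
    qed
    finally show ?thesis .
  qed
  have prod: "accept_prob (2 ^ i) * (1 - \<beta> i) \<le> 2 ^ i * z" for i
  proof -
    have "accept_prob (2 ^ i) \<le> 5 / 2 * (real (2 ^ i))\<^sup>2 * (d / n)" by (rule accept_prob_le) simp
    also have "\<dots> = 5 / 2 * (2 ^ i)\<^sup>2 / r\<^sup>2" by (simp add: r(2))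
    finally have 1: "accept_prob (2 ^ i) \<le> 5 / 2 * (2 ^ i)\<^sup>2 / r\<^sup>2" .
    have "1 - \<beta> i = 4 * r / (2 ^ i * (real (repetitions \<epsilon>) * \<epsilon>\<^sup>2))" by (simp add: \<beta>_def mult_ac)
    also have "\<dots> \<le> 4 * r / (2 ^ i * 10 ^ 9)"
      using R r R0 \<epsilon> by (intro divide_left_mono mult_left_mono mult_pos_pos) auto
    finally have 2: "1 - \<beta> i \<le> 4 * r / (2 ^ i * 10 ^ 9)" .
    have "accept_prob (2 ^ i) * (1 - \<beta> i) \<le> (5 / 2 * (2 ^ i)\<^sup>2 / r\<^sup>2) * (4 * r / (2 ^ i * 10 ^ 9))"
    proof (rule mult_mono[OF 1 2])
      show "0 \<le> 1 - \<beta> i" using r by (simp add: \<beta>_def)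
    qed simp
    also have "\<dots> = 2 ^ i * z" using r(1) by (simp add: z_def power2_eq_square)
    finally show ?thesis .
  qed
  {
    case base
    \<comment> \<open>Rejection in round I is counted as failure, hence the value 0 for going
      on.\<close>
    have "accept_prob (2 ^ I) * \<beta> I + (1 - accept_prob (2 ^ I)) * 0
        \<le> ?S K (doubling_round \<epsilon> I) (10 * 2 ^ I + ?F)"
      by (rule success_doubling_round) (simp_all add: \<beta> success_nonneg)
    moreover have "1 - accept_prob (2 ^ I) \<le> 0.0035" using I by (intro not_accept_prob_le) simp
    ultimately have "1 - (0.0035 + 2 ^ I * z) \<le> ?S K (doubling_round \<epsilon> I) (10 * 2 ^ I + ?F)"
      using prod[of I] by (simp add: algebra_simps)
    then show ?case by (simp add: z_def r_def)
  next
    case (step i)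
    let ?f = "0.0035 + (2 * 2 ^ I - 2 ^ Suc i) * z"
    have le: "(2::real) ^ Suc i \<le> 2 * 2 ^ I" "(2::nat) ^ Suc i \<le> 2 * 2 ^ I"
      using step.hyps power_increasing[of "Suc i" "Suc I" "2::real"]
        power_increasing[of "Suc i" "Suc I" "2::nat"] by auto
    have f: "0 \<le> ?f" using le z by simp
    let ?T = "10 * (2 * 2 ^ I - 2 ^ Suc i) + ?F"
    have "accept_prob (2 ^ i) * \<beta> i + (1 - accept_prob (2 ^ i)) * (1 - ?f)
        \<le> ?S K (doubling_round \<epsilon> i) (10 * 2 ^ i + ?T)"
    proof (rule success_doubling_round)
      show "\<beta> i \<le> ?S K (final_phase (repetitions \<epsilon> * 2 ^ i)) ?T" for K
        using step.hyps by (intro \<beta>) auto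
      show "1 - ?f \<le> ?S K (Output (Inr (Suc i))) ?T" for K
        using step.IH[of K] unfolding success_Output_Inr z_def r_def .
    qed
    moreover have "accept_prob (2 ^ i) * ?f \<ge> 0" using f accept_prob_bounds by (intro mult_nonneg_nonneg)
    \<comment> \<open>For acceptance probability a, success bound b of the final phase and failure
      bound x of the later rounds; the nonnegative term a x is dropped.\<close>
    moreover have "a * b + (1 - a) * (1 - x) = 1 - x - a * (1 - b) + a * x" for a b x :: real
      by (simp add: algebra_simps)
    ultimately have "1 - ?f - 2 ^ i * z \<le> ?S K (doubling_round \<epsilon> i) (10 * 2 ^ i + ?T)"
      using prod[of i] by (simp only:)
    also have "1 - ?f - 2 ^ i * z = 1 - (0.0035 + (2 * 2 ^ I - 2 ^ i) * z)"
      by (simp add: algebra_simps)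
    finally have "1 - (0.0035 + (2 * 2 ^ I - 2 ^ i) * z) \<le> ?S K (doubling_round \<epsilon> i) (10 * 2 ^ i + ?T)" .
    \<comment> \<open>Costs are natural numbers with truncated subtraction, so regrouping relies on
      \<open>le(2)\<close>.\<close>
    also have "10 * 2 ^ i + ?T = 10 * (2 * 2 ^ I - 2 ^ i) + ?F"
    proof -
      have "10 * a + (10 * (2 * b - 2 * a) + c) = 10 * (2 * b - a) + c" if "2 * a \<le> 2 * b" for a b c :: nat
        using that by arith
      from this[of "2 ^ i" "2 ^ I"] le(2) show ?thesis by (simp only: power_Suc)
    qed
    finally show ?case by (simp add: z_def r_def)
  }
qed

theorem run_prob_estimator:
  assumes \<epsilon>: "0 < \<epsilon>" "\<epsilon> < 1"
  shows "0.99 \<le> run_prob Advanced G (estimator \<epsilon>)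
    (\<lambda>r t. eps_approx \<epsilon> G r \<and> real t \<le> 10 ^ 15 * (1 / \<epsilon>\<^sup>2 * sqrt (n / d)))"
proof -
  define r where "r = sqrt (n / d)"
  have r: "r \<ge> 1" using sqrt_n_over_d_ge_1 by (simp add: r_def)
  \<comment> \<open>The first round with 2^I at least 64000 r; rounding up loses at most a factor
    2.\<close>
  define I where "I = nat \<lceil>log 2 (64000 * r)\<rceil>"
  have l0: "0 \<le> log 2 (64000 * r)" using r by simp
  have pw: "2 powr log 2 (64000 * r) = 64000 * r" using r by simp
  have I: "log 2 (64000 * r) \<le> real I" "real I \<le> log 2 (64000 * r) + 1"
    using l0 unfolding I_def by linarith+
  have I1: "64000 * r \<le> 2 ^ I"
    using powr_mono[OF I(1), of 2] pw by (simp add: powr_realpow)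
  have I2: "2 ^ I \<le> 128000 * r"
    using powr_mono[OF I(2), of 2] pw by (simp add: powr_realpow powr_add)
  have e1: "1 \<le> 1 / \<epsilon>\<^sup>2" using \<epsilon> by (simp add: power_le_one)
  have R: "real (repetitions \<epsilon>) \<le> 10 ^ 9 / \<epsilon>\<^sup>2 + 1" unfolding repetitions_def by simp
  \<comment> \<open>Rounds 0 to I cost 10 (1 + 2 + ... + 2^I) in total, followed by the longest
    possible final phase.\<close>
  define T where "T = 10 * (2 * 2 ^ I - 2 ^ 0) + repetitions \<epsilon> * 2 ^ I * 4"
  have T: "real T \<le> 10 ^ 15 * (1 / \<epsilon>\<^sup>2 * r)"
  proof -
    have "T \<le> (20 + 4 * repetitions \<epsilon>) * 2 ^ I" unfolding T_def by (simp add: algebra_simps)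
    then have "real T \<le> (20 + 4 * real (repetitions \<epsilon>)) * 2 ^ I"
      using of_nat_mono[of T "(20 + 4 * repetitions \<epsilon>) * 2 ^ I"] by simp
    also have "\<dots> \<le> (5 * 10 ^ 9 * (1 / \<epsilon>\<^sup>2)) * (128000 * r)"
    proof (rule mult_mono[OF _ I2])
      have "20 + 4 * real (repetitions \<epsilon>) \<le> 24 + 4 * 10 ^ 9 * (1 / \<epsilon>\<^sup>2)" using R by simp
      also have "\<dots> \<le> 5 * 10 ^ 9 * (1 / \<epsilon>\<^sup>2)"
      proof -
        have "24 + 4 * 10 ^ 9 * x \<le> 5 * 10 ^ 9 * x" if "1 \<le> x" for x :: real using that by simp
        then show ?thesis using e1 .
      qed
      finally show "20 + 4 * real (repetitions \<epsilon>) \<le> 5 * 10 ^ 9 * (1 / \<epsilon>\<^sup>2)" .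
    qed simp_all
    also have "\<dots> = 64 * 10 ^ 13 * (1 / \<epsilon>\<^sup>2 * r)" by simp
    also have "\<dots> \<le> 10 ^ 15 * (1 / \<epsilon>\<^sup>2 * r)" using r by (intro mult_right_mono) auto
    finally show ?thesis .
  qed
  \<comment> \<open>The geometric series contributes at most 256000 / 10^8; with 0.0035 for
    rejection in round I the total failure probability is below 0.01.\<close>
  have "(2 * 2 ^ I - 2 ^ 0) * (1 / 10 ^ 8 / r) \<le> (256000 * r) * (1 / 10 ^ 8 / r)"
    using I2 r by (intro mult_right_mono) auto
  also have "\<dots> = 0.00256" using r by simp
  finally have last: "(2 * 2 ^ I - 2 ^ 0) * (1 / 10 ^ 8 / r) \<le> 0.00256" .
  have "0.99 \<le> 1 - (0.0035 + x)" if "x \<le> 0.00256" for x :: real using that by simp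
  from this[OF last] have "0.99 \<le> 1 - (0.0035 + (2 * 2 ^ I - 2 ^ 0) * (1 / 10 ^ 8 / r))" .
  also have "\<dots> \<le> success G (doubling_round \<epsilon>) (eps_approx \<epsilon> G) {} (doubling_round \<epsilon> 0) T"
    unfolding T_def r_def using \<epsilon> I1 by (intro success_doubling_rounds) (auto simp: r_def)
  also have "\<dots> = run_prob Advanced G (estimator \<epsilon>) (\<lambda>r t. eps_approx \<epsilon> G r \<and> t \<le> T)"
    by (simp add: success_def run_prob_def estimator_def)
  also have "\<dots> \<le> run_prob Advanced G (estimator \<epsilon>)
      (\<lambda>x t. eps_approx \<epsilon> G x \<and> real t \<le> 10 ^ 15 * (1 / \<epsilon>\<^sup>2 * r))"
    unfolding run_prob_def using T by (intro measure_spmf.finite_measure_mono) force+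
  finally show ?thesis by (simp only: r_def)
qed

end

section \<open>The lower bound\<close>

lemma pmf_bind_dominates:
  fixes p q :: "'a pmf" and f g :: "'a \<Rightarrow> 'b pmf"
  assumes "0 \<le> b" "0 \<le> c"
    and dom: "\<And>x. b * pmf p x \<le> pmf q x"
    and cont: "\<And>x. x \<in> set_pmf p \<Longrightarrow> c * pmf (f x) y \<le> pmf (g x) z"
  shows "b * c * pmf (bind_pmf p f) y \<le> pmf (bind_pmf q g) z"
proof -
  have pt: "ennreal (b * c) * (ennreal (pmf p x) * ennreal (pmf (f x) y))
      \<le> ennreal (pmf q x) * ennreal (pmf (g x) z)" for x
  proof (cases "x \<in> set_pmf p")
    case True
    have "(b * pmf p x) * (c * pmf (f x) y) \<le> pmf q x * pmf (g x) z"
      using dom cont[OF True] assms(1,2) by (intro mult_mono) auto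
    then show ?thesis
      using assms(1,2) by (simp add: ennreal_mult[symmetric] mult_ac)
  qed (simp add: set_pmf_iff)
  have "ennreal (b * c * pmf (bind_pmf p f) y)
      = (\<integral>\<^sup>+x. ennreal (b * c) * (ennreal (pmf p x) * ennreal (pmf (f x) y)) \<partial>count_space UNIV)"
    using assms(1,2)
    by (simp add: ennreal_mult ennreal_pmf_bind nn_integral_measure_pmf nn_integral_cmult)
  also have "\<dots> \<le> (\<integral>\<^sup>+x. ennreal (pmf q x) * ennreal (pmf (g x) z) \<partial>count_space UNIV)"
    by (intro nn_integral_mono pt)
  also have "\<dots> = ennreal (pmf (bind_pmf q g) z)"
    by (simp add: ennreal_pmf_bind nn_integral_measure_pmf)
  finally show ?thesis by simp
qed

lemma spmf_map_add_cost:
  fixes c t :: nat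
  shows "spmf (map_spmf (\<lambda>(r, t). (r, c + t)) P) (r, t) = (if c \<le> t then spmf P (r, t - c) else 0)"
proof (cases "c \<le> t")
  case True
  have inj: "inj (\<lambda>(r::'a, t). (r, c + t))" by (auto simp: inj_def)
  show ?thesis using True spmf_map_inj'[OF inj, of P "(r, t - c)"] by simp
next
  case False
  have "(r, t) \<notin> set_spmf (map_spmf (\<lambda>(r, t). (r, c + t)) P)" using False by auto
  then show ?thesis using False by (simp add: spmf_eq_0_set_spmf)
qed

text \<open>Every unit of cost loses a factor \<open>c\<close>, so an execution of total cost t
  loses c^t. Fixed-point induction approximates the run on \<open>G\<close>, while the run on
  \<open>G'\<close> stays as it is; \<open>V\<close> contains all identifiers that \<open>G\<close>
  can reveal.\<close>

lemma run_dominates: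
  fixes p :: "'a program"
  assumes c: "0 \<le> c" "c \<le> 1"
    and closed: "\<And>K q a. K \<subseteq> V \<Longrightarrow> a \<in> set_pmf (respond M G K q) \<Longrightarrow> revealed a \<subseteq> V"
    and dom: "\<And>K q a. K \<subseteq> V \<Longrightarrow>
      c ^ query_cost q * pmf (respond M G K q) a \<le> pmf (respond M G' K q) a"
    and K: "K \<subseteq> V"
  shows "c ^ t * spmf (run M G K p) (r, t) \<le> spmf (run M G' K p) (r, t)"
proof -
  define P where "P = (\<lambda>R :: model \<Rightarrow> graph \<Rightarrow> nat set \<Rightarrow> 'a program \<Rightarrow> ('a \<times> nat) spmf.
     \<forall>K p r t. K \<subseteq> V \<longrightarrow> c ^ t * spmf (R M G K p) (r, t) \<le> spmf (run M G' K p) (r, t))"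
  have "P run"
  proof (induction rule: run.fixp_induct[where P = P])
    case 1
    show ?case
      unfolding P_def
    proof (rule ccpo.admissibleI, intro allI impI)
      fix A :: "(((model \<times> graph) \<times> nat set) \<times> 'a program \<Rightarrow> ('a \<times> nat) spmf) set"
        and K p r t
      assume ch: "Complete_Partial_Order.chain spmf.le_fun A" and ne: "A \<noteq> {}"
        and IH: "\<forall>R\<in>A. \<forall>K p r t. K \<subseteq> V \<longrightarrow>
          c ^ t * spmf (curry (curry (curry R)) M G K p) (r, t) \<le> spmf (run M G' K p) (r, t)"
        and K: "K \<subseteq> V"
      let ?Y = "(\<lambda>R. R (((M, G), K), p)) ` A"
      have chY: "Complete_Partial_Order.chain (ord_spmf (=)) {y. \<exists>f\<in>A. y = f (((M, G), K), p)}"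
        by (rule chain_fun[OF ch])
      have eq: "{y. \<exists>f\<in>A. y = f (((M, G), K), p)} = ?Y" by auto
      \<comment> \<open>Admissibility: the mass of a limit at a point is the supremum of the masses,
        to be compared after division by a positive c^t.\<close>
      have "c ^ t * spmf (lub_spmf ?Y) (r, t) \<le> spmf (run M G' K p) (r, t)"
      proof (cases "c ^ t = 0")
        case False
        then have pos: "c ^ t > 0" using c(1) zero_le_power[of c t] by linarith
        have "spmf (lub_spmf ?Y) (r, t) = (SUP y\<in>?Y. spmf y (r, t))"
          by (rule spmf_lub_spmf[OF chY[unfolded eq]]) (use ne in simp)
        also have "\<dots> \<le> spmf (run M G' K p) (r, t) / c ^ t"
        proof (rule cSUP_least)
          fix y assume "y \<in> ?Y"
          then have "c ^ t * spmf y (r, t) \<le> spmf (run M G' K p) (r, t)"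
            using IH K by (auto simp: curry_def)
          then show "spmf y (r, t) \<le> spmf (run M G' K p) (r, t) / c ^ t"
            using pos by (simp add: pos_le_divide_eq mult.commute)
        qed (use ne in simp)
        finally show ?thesis using pos by (simp add: pos_le_divide_eq mult.commute)
      next
        case True
        then show ?thesis by (simp only: mult_zero_left pmf_nonneg)
      qed
      then show "c ^ t * spmf (curry (curry (curry (spmf.lub_fun A))) M G K p) (r, t)
          \<le> spmf (run M G' K p) (r, t)"
        by (simp add: fun_lub_def eq curry_def)
    qed
  next
    case 2
    show ?case by (simp add: P_def)
  next
    case (3 R)
    show ?case
      unfolding P_def
    proof (intro allI impI)
      fix K p r t
      assume K: "K \<subseteq> V"
      have IH: "\<And>K p r t. K \<subseteq> V \<Longrightarrow>
          c ^ t * spmf (R M G K p) (r, t) \<le> spmf (run M G' K p) (r, t)"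
        using 3 by (simp add: P_def)
      show "c ^ t * spmf (case p of Output r \<Rightarrow> return_spmf (r, 0)
            | Query q f \<Rightarrow> bind_spmf (spmf_of_pmf (respond M G K q))
                (\<lambda>a. map_spmf (\<lambda>(r, t). (r, query_cost q + t)) (R M G (K \<union> revealed a) (f a)))
            | Choose D \<Rightarrow> bind_spmf (spmf_of_pmf D) (R M G K)) (r, t)
          \<le> spmf (run M G' K p) (r, t)"
      proof (cases p)
        case (Output x)
        then show ?thesis
          by (cases t) (auto simp: run_Output indicator_def)
      next
        case (Choose D)
        have "1 * c ^ t * spmf (bind_pmf D (R M G K)) (r, t) \<le> spmf (bind_pmf D (run M G' K)) (r, t)"
          by (rule pmf_bind_dominates) (use c IH[OF K] in auto)
        then show ?thesis using Choose by (simp add: run_Choose)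
      next
        case (Query q f)
        let ?m = "map_spmf (\<lambda>(r, t). (r, query_cost q + t)) :: ('a \<times> nat) spmf \<Rightarrow> _"
        show ?thesis
        proof (cases "query_cost q \<le> t")
          case True
          have "c ^ query_cost q * c ^ (t - query_cost q) *
             spmf (bind_pmf (respond M G K q) (\<lambda>a. ?m (R M G (K \<union> revealed a) (f a)))) (r, t)
             \<le> spmf (bind_pmf (respond M G' K q) (\<lambda>a. ?m (run M G' (K \<union> revealed a) (f a)))) (r, t)"
          proof (rule pmf_bind_dominates)
            fix a assume "a \<in> set_pmf (respond M G K q)"
            then have "K \<union> revealed a \<subseteq> V" using closed K by blast
            then show "c ^ (t - query_cost q) * spmf (?m (R M G (K \<union> revealed a) (f a))) (r, t)
                \<le> spmf (?m (run M G' (K \<union> revealed a) (f a))) (r, t)"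
              using IH True by (simp add: spmf_map_add_cost)
          qed (use c dom[OF K] in auto)
          then show ?thesis
            using Query True by (simp add: run_Query power_add[symmetric])
        next
          case False
          \<comment> \<open>A run whose first query already costs more than t cannot have total cost
            t.\<close>
          then have "spmf (bind_pmf (respond M G K q)
              (\<lambda>a. ?m (R M G (K \<union> revealed a) (f a)))) (r, t) = 0"
            by (auto simp: pmf_bind spmf_map_add_cost)
          then show ?thesis using Query by simp
        qed
      qed
    qed
  qed
  then show ?thesis using K by (simp add: P_def)
qed

section \<open>The pair of hard instances\<close>

text \<open>About n / 2 edges, rounded up, cover all vertices, which excludes isolated ones; this
  set is extended arbitrarily to m edges.\<close>

lemma exists_input_graph:
  assumes "2 \<le> n" "n \<le> 2 * m" "m \<le> n choose 2"
  obtains G where "input_graph G" "verts G = {..<n}" "card (edges G) = m"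
proof -
  \<comment> \<open>Within \<open>E0\<close> the second branch is reached only for the last vertex
    2i = n - 1 of an odd n, which has no partner and is joined to 0.\<close>
  define f :: "nat \<Rightarrow> nat set" where "f i = (if 2 * i + 1 < n then {2 * i, 2 * i + 1} else {0, 2 * i})" for i
  define E0 where "E0 = f ` {..<(n + 1) div 2}"
  define F where "F = {e. e \<subseteq> {..<n} \<and> card e = 2}"
  have "E0 \<subseteq> F" using assms(1) by (auto simp: E0_def F_def f_def)
  moreover have "card E0 \<le> m"
    using card_image_le[of "{..<(n + 1) div 2}" f] assms(2) by (simp add: E0_def)
  moreover have "finite F" "m \<le> card F"
    using assms(3) n_subsets[of "{..<n}" 2] by (auto simp: F_def)
  ultimately obtain E where E: "E0 \<subseteq> E" "E \<subseteq> F" "card E = m"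
    using exists_subset_between[of E0 m F] by metis
  have "nbrs ({..<n}, E) x \<noteq> {}" if "x < n" for x
  proof -
    have "f (x div 2) \<in> E" using that E(1) by (auto simp: E0_def)
    moreover have "\<exists>y. f (x div 2) = {x, y}"
    proof (cases "even x")
      case True
      then show ?thesis by (auto simp: f_def)
    next
      case False
      then have "2 * (x div 2) + 1 = x" by simp
      then show ?thesis using that by (auto simp: f_def insert_commute)
    qed
    ultimately show ?thesis by (auto simp: nbrs_def)
  qed
  then have "input_graph ({..<n}, E)"
    using E(2) assms(1) by (auto simp: input_graph_def simple_graph_def no_isolated_def F_def lessThan_empty_iff)
  then show ?thesis using that E(3) by auto
qed

definition add_clique :: "nat \<Rightarrow> nat \<Rightarrow> graph \<Rightarrow> graph" where
  "add_clique n k G = ({..<n + k}, edges G \<union> {e. e \<subseteq> {n..<n + k} \<and> card e = 2})"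

lemma clique_part_disjoint:
  assumes "simple_graph G" "verts G = {..<n}" "e \<in> edges G"
  shows "\<not> e \<subseteq> {n..<n + k}"
proof
  assume "e \<subseteq> {n..<n + k}"
  moreover have "e \<subseteq> {..<n}" "card e = 2" using assms by (auto simp: simple_graph_def)
  ultimately have "e = {}" by fastforce
  then show False using \<open>card e = 2\<close> by simp
qed

lemma card_edges_add_clique:
  assumes "simple_graph G" "verts G = {..<n}"
  shows "card (edges (add_clique n k G)) = card (edges G) + (k choose 2)"
proof -
  have "card (edges (add_clique n k G)) = card (edges G) + card {e. e \<subseteq> {n..<n + k} \<and> card e = 2}"
    unfolding add_clique_def snd_conv
    by (rule card_Un_disjoint) (use finite_edges[OF assms(1)] clique_part_disjoint[OF assms] in auto)
  then show ?thesis using n_subsets[of "{n..<n + k}" 2] by simp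
qed

lemma nbrs_add_clique:
  assumes "x < n"
  shows "nbrs (add_clique n k G) x = nbrs G x"
  using assms by (auto simp: nbrs_def add_clique_def)

lemma input_graph_add_clique:
  assumes G: "input_graph G" "verts G = {..<n}" and k: "2 \<le> k"
  shows "input_graph (add_clique n k G)"
proof -
  have "nbrs (add_clique n k G) x \<noteq> {}" if x: "x < n + k" for x
  proof (cases "x < n")
    case True
    then show ?thesis using G nbrs_add_clique[OF True] by (auto simp: input_graph_def no_isolated_def)
  next
    case False
    have "\<exists>y \<in> {n..<n + k}. y \<noteq> x"
      using k by (intro bexI[of _ "if x = n then n + 1 else n"]) auto
    then obtain y where "y \<in> {n..<n + k}" "y \<noteq> x" by blast
    then have "y \<in> nbrs (add_clique n k G) x"
      using False x by (auto simp: nbrs_def add_clique_def)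
    then show ?thesis by blast
  qed
  moreover have "simple_graph (add_clique n k G)"
    unfolding simple_graph_def
  proof (intro conjI ballI)
    fix e assume "e \<in> edges (add_clique n k G)"
    then consider "e \<in> edges G" | "e \<subseteq> {n..<n + k}" "card e = 2"
      by (auto simp: add_clique_def)
    then have "e \<subseteq> {..<n + k} \<and> card e = 2"
    proof cases
      case 1
      then have "e \<subseteq> {..<n}" "card e = 2" using G by (auto simp: input_graph_def simple_graph_def)
      then show ?thesis using subset_trans[of e "{..<n}" "{..<n + k}"] by simp
    next
      case 2
      then show ?thesis using subset_trans[of e "{n..<n + k}" "{..<n + k}"] by auto
    qed
    then show "e \<subseteq> verts (add_clique n k G)" "card e = 2" by (auto simp: add_clique_def)
  qed (use k in \<open>auto simp: add_clique_def lessThan_empty_iff\<close>)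
  ultimately show ?thesis by (auto simp: input_graph_def no_isolated_def add_clique_def)
qed

text \<open>Supplies the closure condition of \<open>run_dominates\<close>; the sets sampled from
  are finite and nonempty, so \<open>pmf_of_set\<close> stays within them.\<close>

lemma revealed_respond:
  assumes "input_graph G" "K \<subseteq> verts G" "a \<in> set_pmf (respond M G K q)"
  shows "revealed a \<subseteq> verts G"
proof (cases "offers M q \<and> mentioned q \<subseteq> K")
  case True
  have s: "simple_graph G" and "finite (verts G)" "verts G \<noteq> {}"
    using assms by (auto simp: input_graph_def simple_graph_def)
  moreover have "nbrs G x \<noteq> {}" if "x \<in> verts G" for x
    using assms that by (auto simp: input_graph_def no_isolated_def)
  ultimately show ?thesis
    using assms(2,3) True nbrs_subset_verts[OF s] finite_nbrs[OF s]
    by (cases q) (auto simp: respond_def set_pmf_of_set subset_iff)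
next
  case False
  then have "respond M G K q = return_pmf Refused" unfolding respond_def by (simp only: if_False)
  then show ?thesis using assms(3) by simp
qed

text \<open>Only \<open>RandVert\<close> can tell the graphs apart: the probability 1 / n of an old
  vertex becomes 1 / (n + k). Any other query that is not refused mentions only old vertices, whose
  neighborhoods and spanned edges are unchanged; this covers both models.\<close>

lemma respond_add_clique:
  assumes G: "simple_graph G" "verts G = {..<n}" and K: "K \<subseteq> {..<n}" and n: "n > 0"
  shows "(real n / real (n + k)) ^ query_cost q * pmf (respond M G K q) a
      \<le> pmf (respond M (add_clique n k G) K q) a"
proof (cases "offers M q \<and> mentioned q \<subseteq> K \<and> q = RandVert")
  case True
  have inj: "inj Vertex" by (auto simp: inj_def)
  show ?thesis
  proof (cases "a \<in> range Vertex")
    case True': True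
    then obtain v where a: "a = Vertex v" by blast
    have "pmf (pmf_of_set {..<n}) v * (real n / real (n + k)) \<le> pmf (pmf_of_set {..<n + k}) v"
      using n by (auto simp: lessThan_empty_iff indicator_def)
    then show ?thesis
      using True G(2) by (simp add: respond_def a add_clique_def pmf_map_inj'[OF inj] mult.commute)
  next
    case False
    then have "pmf (respond M G K q) a = 0"
      using True by (auto simp: respond_def pmf_eq_0_set_pmf)
    then show ?thesis by simp
  qed
next
  case False
  have eq: "respond M (add_clique n k G) K q = respond M G K q"
  proof (cases "offers M q \<and> mentioned q \<subseteq> K")
    case True
    have add: "{e \<in> edges (add_clique n k G). e \<subseteq> S} = {e \<in> edges G. e \<subseteq> S}" if "S \<subseteq> {..<n}" for S
    proof -
      have "\<not> (e \<subseteq> {n..<n + k} \<and> card e = 2 \<and> e \<subseteq> S)" for e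
      proof
        assume *: "e \<subseteq> {n..<n + k} \<and> card e = 2 \<and> e \<subseteq> S"
        then have "e = {}" using that by fastforce
        then show False using * by simp
      qed
      then show ?thesis by (auto simp: add_clique_def)
    qed
    show ?thesis
    proof (cases q)
      case (Additive S)
      then have "S \<subseteq> {..<n}" using True K by auto
      then show ?thesis using Additive add by (simp add: respond_def)
    qed (use True False K in \<open>auto simp: respond_def nbrs_add_clique\<close>)
  next
    case False
    then show ?thesis unfolding respond_def by (simp only: if_False)
  qed
  have "(real n / real (n + k)) ^ query_cost q \<le> 1"
    using n by (intro power_le_one) (auto simp: divide_le_eq_1)
  then show ?thesis unfolding eq by (simp add: mult_left_le_one_le)
qed

section \<open>Transfer of probabilities to the enlarged graph\<close>

lemma measure_spmf_dominates:
  assumes "0 \<le> b" and dom: "\<And>x. x \<in> A \<Longrightarrow> b * spmf P x \<le> spmf Q x"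
  shows "b * measure (measure_spmf P) A \<le> measure (measure_spmf Q) A"
proof -
  have em: "emeasure (measure_spmf R) A = (\<integral>\<^sup>+x. ennreal (spmf R x) * indicator A x \<partial>count_space UNIV)"
    for R :: "'a spmf"
    using nn_integral_measure_spmf[of R "indicator A"] by simp
  have "ennreal (b * measure (measure_spmf P) A) = ennreal b * emeasure (measure_spmf P) A"
    using assms(1) by (simp add: ennreal_mult measure_spmf.emeasure_eq_measure)
  also have "\<dots> = (\<integral>\<^sup>+x. ennreal b * (ennreal (spmf P x) * indicator A x) \<partial>count_space UNIV)"
    by (simp add: em nn_integral_cmult)
  also have "\<dots> \<le> (\<integral>\<^sup>+x. ennreal (spmf Q x) * indicator A x \<partial>count_space UNIV)"
  proof (intro nn_integral_mono)
    fix x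
    show "ennreal b * (ennreal (spmf P x) * indicator A x) \<le> ennreal (spmf Q x) * indicator A x"
      using dom[of x] assms(1) by (cases "x \<in> A") (auto simp: ennreal_mult[symmetric] ennreal_leI)
  qed
  also have "\<dots> = ennreal (measure (measure_spmf Q) A)"
    by (simp add: em[symmetric] measure_spmf.emeasure_eq_measure)
  finally show ?thesis by simp
qed

lemma run_prob_mono:
  "(\<And>r t. P r t \<Longrightarrow> Q r t) \<Longrightarrow> run_prob M G A P \<le> run_prob M G A Q"
  unfolding run_prob_def by (intro measure_spmf.finite_measure_mono) auto

lemma run_prob_disj_le:
  "run_prob M G A (\<lambda>r t. P r t \<or> Q r t) \<le> run_prob M G A P + run_prob M G A Q"
proof -
  have "{(r, t). P r t \<or> Q r t} = {(r, t). P r t} \<union> {(r, t). Q r t}" by auto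
  then show ?thesis unfolding run_prob_def by (simp add: measure_Un_le)
qed

lemma run_prob_disjoint_sum_le_1:
  assumes "\<And>r t. P r t \<Longrightarrow> \<not> Q r t"
  shows "run_prob M G A P + run_prob M G A Q \<le> 1"
proof -
  have "run_prob M G A P + run_prob M G A Q
      = measure (measure_spmf (run M G {} A)) ({(r, t). P r t} \<union> {(r, t). Q r t})"
    unfolding run_prob_def using assms
    by (subst measure_spmf.finite_measure_Union) auto
  then show ?thesis by (simp add: measure_spmf.subprob_measure_le_1)
qed

text \<open>An execution of cost t < T keeps at least the fraction (1 - k / (n + k))^t of its
  probability, which by Bernoulli's inequality is at least 1 - t k / (n + k), hence at least
  1/2.\<close>

lemma run_prob_add_clique:
  assumes G: "input_graph G" "verts G = {..<n}"
    and n: "n > 0" and T: "2 * T * real k \<le> real (n + k)"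
  shows "run_prob M G A (\<lambda>r t. P r \<and> real t < T) / 2
      \<le> run_prob M (add_clique n k G) A (\<lambda>r t. P r \<and> real t < T)"
proof -
  define c where "c = real n / real (n + k)"
  have c: "0 \<le> c" "c \<le> 1" using n by (auto simp: c_def)
  have sG: "simple_graph G" using G by (simp add: input_graph_def)
  have "1 / 2 * spmf (run M G {} A) x \<le> spmf (run M (add_clique n k G) {} A) x"
    if "x \<in> {(r, t). P r \<and> real t < T}" for x
  proof -
    obtain r t where x: "x = (r, t)" "real t < T" using \<open>x \<in> _\<close> by auto
    have "1 / 2 \<le> 1 - real t * (real k / real (n + k))"
    proof -
      have "real t * real k \<le> T * real k" using x by (intro mult_right_mono) auto
      then have "2 * (real t * real k) \<le> real (n + k)" using T by linarith
      then show ?thesis using n by (simp add: field_simps)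
    qed
    also have "\<dots> = 1 + real t * (- (real k / real (n + k)))" by simp
    also have "\<dots> \<le> (1 + (- (real k / real (n + k)))) ^ t"
      using n by (intro Bernoulli_inequality) (auto simp: field_simps)
    also have "1 + (- (real k / real (n + k))) = c" using n by (simp add: c_def field_simps)
    finally have "1 / 2 * spmf (run M G {} A) x \<le> c ^ t * spmf (run M G {} A) x"
      by (intro mult_right_mono) auto
    also have "\<dots> \<le> spmf (run M (add_clique n k G) {} A) x"
      unfolding x(1)
    proof (rule run_dominates[OF c, where V = "{..<n}"])
      show "revealed a \<subseteq> {..<n}" if "K \<subseteq> {..<n}" "a \<in> set_pmf (respond M G K q)" for K q a
        using revealed_respond[OF G(1)] that G(2) by blast
    qed (use respond_add_clique[OF sG G(2) _ n] in \<open>auto simp: c_def\<close>)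
    finally show ?thesis .
  qed
  then have "1 / 2 * run_prob M G A (\<lambda>r t. P r \<and> real t < T)
      \<le> run_prob M (add_clique n k G) A (\<lambda>r t. P r \<and> real t < T)"
    unfolding run_prob_def by (intro measure_spmf_dominates) simp_all
  then show ?thesis by simp
qed

text \<open>For s = sqrt (2 m), the clique on about b s vertices adds at least b^2 s^2 / 2 to the
  degree sum s^2, while the number of vertices grows by a factor of at most b + 2. It remains to see
  that c^2 (b + 2) < b^2 / 2.\<close>

lemma avg_degree_add_clique:
  assumes G: "input_graph G" "verts G = {..<n}" and n: "n > 0" and m: "card (edges G) = m" "m > 0"
    and b: "b \<ge> 8" "16 * c\<^sup>2 \<le> b * 2" and k: "b * sqrt (2 * m) \<le> real k" "real k \<le> b * sqrt (2 * m) + 1"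
    and mn: "2 * real m \<le> (real n)\<^sup>2"
  shows "c\<^sup>2 * avg_degree G < avg_degree (add_clique n k G)"
proof -
  define s where "s = sqrt (2 * m)"
  have s2: "s\<^sup>2 = 2 * m" by (simp add: s_def)
  have s: "1 \<le> s" using m by (simp add: s_def)
  have sn: "s \<le> n" using mn unfolding s_def by (intro real_le_lsqrt) auto
  have sG: "simple_graph G" using G by (simp add: input_graph_def)
  have k8: "8 \<le> real k"
  proof -
    have "8 * 1 \<le> b * s" using b s by (intro mult_mono) auto
    then show ?thesis using k(1) by (simp add: s_def)
  qed
  have kn: "real (n + k) \<le> (b + 2) * n"
  proof -
    have "b * s \<le> b * n" using sn b by (intro mult_left_mono) auto
    then show ?thesis using k(2) n by (simp add: algebra_simps s_def)
  qed
  have ch: "2 * real (k choose 2) = real k * (real k - 1)"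
  proof -
    have "2 dvd k * (k - 1)" by (cases "even k") auto
    then have "2 * (k choose 2) = k * (k - 1)" by (simp add: choose_two)
    then have "real (2 * (k choose 2)) = real (k * (k - 1))" by (rule arg_cong)
    then show ?thesis using k8 by (simp add: of_nat_diff)
  qed
  have "(b * s)\<^sup>2 / 2 \<le> (real k)\<^sup>2 / 2"
    using k(1) b s by (intro divide_right_mono power_mono) (auto simp: s_def)
  also have "\<dots> \<le> real k * (real k - 1)"
  proof -
    have "real k / 2 \<le> real k - 1" using k8 by simp
    then have "real k * (real k / 2) \<le> real k * (real k - 1)" using k8 by (intro mult_left_mono) auto
    then show ?thesis by (simp add: power2_eq_square)
  qed
  finally have kk: "(b * s)\<^sup>2 / 2 \<le> real k * (real k - 1)" .
  have "c\<^sup>2 * (b + 2) < b\<^sup>2 / 2"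
  proof -
    have "c\<^sup>2 * (b + 2) \<le> (b / 8) * (b + 2)" using b by (intro mult_right_mono) auto
    also have "\<dots> \<le> (b / 8) * (2 * b)" using b by (intro mult_left_mono) auto
    also have "\<dots> < b\<^sup>2 / 2" using b by (simp add: power2_eq_square)
    finally show ?thesis .
  qed
  then have "(c\<^sup>2 * (b + 2)) * s\<^sup>2 < b\<^sup>2 / 2 * s\<^sup>2" using s by (intro mult_strict_right_mono) auto
  also have "\<dots> = (b * s)\<^sup>2 / 2" by (simp add: power_mult_distrib)
  also note kk
  also have "real k * (real k - 1) \<le> s\<^sup>2 + real k * (real k - 1)" by simp
  finally have *: "c\<^sup>2 * s\<^sup>2 * (b + 2) < s\<^sup>2 + real k * (real k - 1)"
    by (simp only: mult.assoc mult.commute[of "b + 2"])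
  have "c\<^sup>2 * s\<^sup>2 * real (n + k) \<le> c\<^sup>2 * s\<^sup>2 * ((b + 2) * n)" using kn by (intro mult_left_mono) auto
  also have "\<dots> = c\<^sup>2 * s\<^sup>2 * (b + 2) * n" by simp
  also have "\<dots> < (s\<^sup>2 + real k * (real k - 1)) * n" using * n by (intro mult_strict_right_mono) auto
  finally have "c\<^sup>2 * (s\<^sup>2 / n) < (s\<^sup>2 + real k * (real k - 1)) / real (n + k)"
    using n by (simp only: pos_less_divide_eq pos_divide_less_eq times_divide_eq_right
      times_divide_eq_left of_nat_0_less_iff add_pos_nonneg zero_le)
  moreover have "avg_degree G = s\<^sup>2 / n" using G m s2 by (simp add: avg_degree_def)
  moreover have "avg_degree (add_clique n k G) = (s\<^sup>2 + real k * (real k - 1)) / real (n + k)"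
    unfolding avg_degree_def card_edges_add_clique[OF sG G(2)] using m s2 ch
    by (simp add: add_clique_def)
  ultimately show ?thesis by simp
qed

text \<open>If with probability above 0.09 the program were correct on \<open>G\<close> at cost
  below T, then with probability above 0.045 it would return the same kind of value on the graph
  with the clique. No value approximates both average degrees up to \<open>c\<close>, so it would be
  wrong there too often.\<close>

theorem query_lower_bound:
  assumes c: "c \<ge> 1"
  shows "\<exists>\<gamma>>0. \<forall>(M :: model) (A :: real program).
        (\<forall>G. input_graph G \<longrightarrow> run_prob M G A (\<lambda>r t. factor_approx c G r) \<ge> 0.99) \<longrightarrow>
        (\<forall>n m :: nat. 2 \<le> n \<and> n \<le> 2 * m \<and> m \<le> n choose 2 \<longrightarrow>
           (\<exists>G. input_graph G \<and> card (verts G) = n \<and> card (edges G) = m \<and>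
              run_prob M G A (\<lambda>r t. real t \<ge> \<gamma> * sqrt (real n / avg_degree G)) \<ge> 0.9))"
proof -
  \<comment> \<open>\<open>b\<close> is the least value with c^2 \<le> b / 8, as the growth of the
    average degree by more than c^2 requires.\<close>
  define b where "b = 8 * c\<^sup>2"
  define \<gamma> where "\<gamma> = 1 / (2 * (b + 1))"
  have b: "b \<ge> 8" using c by (simp add: b_def)
  have "\<exists>G. input_graph G \<and> card (verts G) = n \<and> card (edges G) = m \<and>
              run_prob M G A (\<lambda>r t. real t \<ge> \<gamma> * sqrt (real n / avg_degree G)) \<ge> 0.9"
    if correct: "\<And>G. input_graph G \<Longrightarrow> run_prob M G A (\<lambda>r t. factor_approx c G r) \<ge> 0.99"
      and nm: "2 \<le> n" "n \<le> 2 * m" "m \<le> n choose 2"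
    for M and A :: "real program" and n m
  proof -
    obtain G where G: "input_graph G" "verts G = {..<n}" "card (edges G) = m"
      using exists_input_graph[OF nm] .
    define s where "s = sqrt (2 * m)"
    define k where "k = nat \<lceil>b * s\<rceil>"
    define T where "T = \<gamma> * sqrt (real n / avg_degree G)"
    have s: "1 \<le> s" using nm by (simp add: s_def)
    have k: "b * s \<le> real k" "real k \<le> b * s + 1" using b s by (auto simp: k_def)
    have k2: "2 \<le> k"
    proof -
      have "8 * 1 \<le> b * s" using b s by (intro mult_mono) auto
      then show ?thesis using k(1) by linarith
    qed
    have mn: "2 * real m \<le> (real n)\<^sup>2"
    proof -
      have "2 * m \<le> n * (n - 1)" using nm(3) by (simp add: choose_two)
      also have "\<dots> \<le> n * n" by simp
      finally show ?thesis by (metis of_nat_le_iff of_nat_mult of_nat_numeral power2_eq_square)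
    qed
    have sn: "s \<le> n" using mn unfolding s_def by (intro real_le_lsqrt) auto
    have T: "T = \<gamma> * (n / s)"
      using nm by (simp add: T_def avg_degree_def G s_def real_sqrt_divide power2_eq_square[symmetric] real_sqrt_mult)
    \<comment> \<open>Since k \<le> b s + 1 \<le> (b + 1) s and T = \<gamma> n / s, the choice of
      \<gamma> makes this bound exactly n.\<close>
    have "2 * T * real k \<le> 2 * T * ((b + 1) * s)"
      using k s b by (intro mult_left_mono) (auto simp: T \<gamma>_def algebra_simps)
    also have "\<dots> = (2 * (b + 1) * \<gamma>) * (s / s) * n" by (simp add: T)
    also have "\<dots> = n" using s b by (simp add: \<gamma>_def)
    finally have Tk: "2 * T * real k \<le> real (n + k)" by simp
    define G' where "G' = add_clique n k G"
    have G': "input_graph G'" unfolding G'_def by (rule input_graph_add_clique[OF G(1,2) k2])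
    have deg: "c\<^sup>2 * avg_degree G < avg_degree G'"
      unfolding G'_def
      by (rule avg_degree_add_clique[where b = b])
         (use G nm b k mn in \<open>auto simp: b_def s_def\<close>)
    have sep: "\<not> factor_approx c G' r" if "factor_approx c G r" for r
    proof
      assume "factor_approx c G' r"
      then have "avg_degree G' / c \<le> c * avg_degree G" using that by (auto simp: factor_approx_def)
      then show False using deg c by (simp add: field_simps power2_eq_square)
    qed
    let ?E = "\<lambda>r t. factor_approx c G r \<and> real t < T"
    have "run_prob M G A (\<lambda>r t. real t \<ge> T) \<ge> 0.9"
    proof (rule ccontr)
      assume *: "\<not> run_prob M G A (\<lambda>r t. real t \<ge> T) \<ge> 0.9"
      have "0.99 \<le> run_prob M G A (\<lambda>r t. factor_approx c G r)" using correct[OF G(1)] .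
      also have "\<dots> \<le> run_prob M G A (\<lambda>r t. real t \<ge> T \<or> ?E r t)" by (rule run_prob_mono) auto
      also have "\<dots> \<le> run_prob M G A (\<lambda>r t. real t \<ge> T) + run_prob M G A ?E"
        by (rule run_prob_disj_le)
      finally have "0.09 < run_prob M G A ?E" using * by simp
      moreover have "run_prob M G A ?E / 2 \<le> run_prob M G' A ?E"
        unfolding G'_def by (rule run_prob_add_clique[OF G(1,2) _ Tk]) (use nm in auto)
      moreover have "run_prob M G' A ?E + run_prob M G' A (\<lambda>r t. factor_approx c G' r) \<le> 1"
        by (rule run_prob_disjoint_sum_le_1) (use sep in auto)
      ultimately show False using correct[OF G'] by simp
    qed
    then show ?thesis using G by (intro exI[of _ G]) (auto simp: T_def)
  qed
  moreover have "\<gamma> > 0" using b by (simp add: \<gamma>_def)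
  ultimately show ?thesis by blast
qed

theorem theorem1p4:
  shows
    "(\<exists>(A :: real \<Rightarrow> real program) (C :: real) (k :: nat). C > 0 \<and>
        (\<forall>\<epsilon> G. 0 < \<epsilon> \<and> \<epsilon> < 1 \<and> input_graph G \<longrightarrow>
           run_prob Advanced G (A \<epsilon>)
             (\<lambda>r t. eps_approx \<epsilon> G r \<and>
                real t \<le> C * (log 2 (real (card (verts G)))) ^ k
                           * ((1 / \<epsilon>\<^sup>2) * sqrt (real (card (verts G)) / avg_degree G)))
           \<ge> 0.99))
     \<and>
     (\<forall>c\<ge>1. \<exists>\<gamma>>0. \<forall>(M :: model) (A :: real program).
        (\<forall>G. input_graph G \<longrightarrow> run_prob M G A (\<lambda>r t. factor_approx c G r) \<ge> 0.99) \<longrightarrow>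
        (\<forall>n m :: nat. 2 \<le> n \<and> n \<le> 2 * m \<and> m \<le> n choose 2 \<longrightarrow>
           (\<exists>G. input_graph G \<and> card (verts G) = n \<and> card (edges G) = m \<and>
              run_prob M G A (\<lambda>r t. real t \<ge> \<gamma> * sqrt (real n / avg_degree G)) \<ge> 0.9)))"
proof (intro conjI)
  show "\<exists>(A :: real \<Rightarrow> real program) (C :: real) (k :: nat). C > 0 \<and>
      (\<forall>\<epsilon> G. 0 < \<epsilon> \<and> \<epsilon> < 1 \<and> input_graph G \<longrightarrow>
         run_prob Advanced G (A \<epsilon>)
           (\<lambda>r t. eps_approx \<epsilon> G r \<and>
              real t \<le> C * (log 2 (real (card (verts G)))) ^ k
                         * ((1 / \<epsilon>\<^sup>2) * sqrt (real (card (verts G)) / avg_degree G)))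
         \<ge> 0.99)"
    \<comment> \<open>The witnesses are the constant 10^15 and the exponent 0, as the cost bound of
      the estimator is free of logarithms.\<close>
    using query_input.run_prob_estimator[OF query_input.intro]
    by (intro exI[of _ estimator] exI[of _ "10 ^ 15"] exI[of _ 0]) simp
qed (use query_lower_bound in blast)

end
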